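(* Let $d$ be a positive integer, let $X$ be a random element of $\mathcal{P}_d$ (a random $d\times d$ stochastic matrix), and let $\{X(n)\}_{n\ge1}$ be an i.i.d. sequence with $X(1)\stackrel{d}{=}X$. Put $X(n,1):=X(n)X(n-1)\cdots X(1)$. Consider the following two conditions on $X$. [C1] There exists $\boldsymbol{t}\in(0,\infty)^d$ such that, for a random vector $\boldsymbol{V}\sim G_{\boldsymbol{t}}$ independent of $X$, one has $\boldsymbol{V}X\stackrel{d}{=}\boldsymbol{V}$. [C2] There exists $m<\infty$ such that $\mathbb{P}(X(m,1)\in\mathcal{P}_d^+)>0$. Then: (i) $\mathcal{L}(X)\in\mathscr{K}_d$ if and only if both [C1] and [C2] hold for $X$. (ii) If $\mathcal{L}(X)\in\mathscr{K}_d$, then the first row $\widehat{X}^{(1)}$ of the almost sure limit $\widehat{X}=\lim_{n\to\infty}X(n,1)$ satisfies $\widehat{X}^{(1)}\sim D_{\boldsymbol{t}}$, where $\boldsymbol{t}$ is the same vector as in [C1]; and if $\boldsymbol{Y}$ is a random element of the simplex $\mathcal{S}_d$ independent of $X$, then $\boldsymbol{Y}X\stackrel{d}{=}\boldsymbol{Y}$ if and only if $\boldsymbol{Y}\stackrel{d}{=}\widehat{X}^{(1)}$.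
   Context: $\mathcal{P}_d$ is the set of $d\times d$ stochastic matrices (non-negative entries, all row sums equal to $1$), and $\mathcal{P}_d^+\subset\mathcal{P}_d$ is the subset of those with all entries strictly positive. $\mathcal{S}_d=\{(x_1,\ldots,x_d): x_i\ge0,\ \sum_i x_i=1\}$. Vectors are row vectors. $\mathcal{L}(X)$ denotes the distribution of $X$; $Z\sim F$ means $Z$ has distribution $F$; $\stackrel{d}{=}$ denotes equality in distribution. For $u>0$, $\Gamma_u$ is the Gamma distribution with scale parameter $1$ and shape parameter $u$ (density $x^{u-1}e^{-x}/\Gamma(u)$ on $(0,\infty)$). For $\boldsymbol{a}=(a_1,\ldots,a_d)\in(0,\infty)^d$, $G_{\boldsymbol{a}}=\Gamma_{a_1}\otimes\cdots\otimes\Gamma_{a_d}$ is the law of a row vector with independent components, the $i$th being $\Gamma_{a_i}$-distributed, and $D_{\boldsymbol{a}}$ is the Dirichlet distribution with parameter $\boldsymbol{a}$ on $\mathcal{S}_d$, with density $\Gamma(\sum_i a_i)\prod_{i=1}^d x_i^{a_i-1}/\Gamma(a_i)$ with respect to the $(d-1)$-dimensional volume measure on $\mathcal{S}_d$ (normalised as Lebesgue measure in the coordinates $x_1,\ldots,x_{d-1}$; for $d=1$ it is the point mass at $1$). $\mathscr{K}_d$ is the class of all distributions $\mathcal{L}(X)$ of random $d\times d$ stochastic matrices $X$ such that, for an i.i.d. sequence $\{X(n)\}_{n\ge1}$ of copies of $X$: [A1] the products $X(n,1)=X(n)X(n-1)\cdots X(1)$ converge almost surely to some random matrix $\widehat{X}$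 as $n\to\infty$; [A2] the limit $\widehat{X}$ has identical rows almost surely; [A3] the rows of $\widehat{X}$ are Dirichlet distributed, i.e. have law $D_{\boldsymbol{a}}$ for some $\boldsymbol{a}\in(0,\infty)^d$. *)

theory Defs
  imports "HOL-Probability.Probability"
begin

text \<open>
  Throughout, \<open>d\<close> is the cardinality of a finite, linearly ordered index type \<open>'n\<close>, whose elements
  play the role of \<open>1 < \<dots> < d\<close>. All laws are Borel measures on \<open>real^'n\<close> or \<open>real^'n^'n\<close>.
\<close>

definition first_ix :: "'n::{finite,linorder}" where
  "first_ix = Min UNIV"

definition last_ix :: "'n::{finite,linorder}" where
  "last_ix = Max UNIV"

definition stochastic_mats :: "(real^'n::finite^'n) set" where
  "stochastic_mats = {A. (\<forall>i j. 0 \<le> A $ i $ j) \<and> (\<forall>i. (\<Sum>j\<in>UNIV. A $ i $ j) = 1)}"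

definition pos_stochastic_mats :: "(real^'n::finite^'n) set" where
  "pos_stochastic_mats = {A \<in> stochastic_mats. \<forall>i j. 0 < A $ i $ j}"

definition prob_simplex :: "(real^'n::finite) set" where
  "prob_simplex = {x. (\<forall>i. 0 \<le> x $ i) \<and> (\<Sum>i\<in>UNIV. x $ i) = 1}"

definition pos_vecs :: "(real^'n::finite) set" where
  "pos_vecs = {x. \<forall>i. 0 < x $ i}"


definition gamma_law :: "real \<Rightarrow> real measure" where
  "gamma_law u = density lborel
     (\<lambda>x. ennreal (if 0 < x then x powr (u - 1) * exp (- x) / Gamma u else 0))"

definition gamma_vec_law :: "real^'n::finite \<Rightarrow> (real^'n) measure" where
  "gamma_vec_law a = distr (Pi\<^sub>M UNIV (\<lambda>i. gamma_law (a $ i))) borel (\<lambda>x. \<chi> i. x i)"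

text \<open>
  The volume measure on the hyperplane of vectors with coordinate sum \<open>1\<close>, namely Lebesgue measure
  in all coordinates but the last. For \<open>d = 1\<close> the product below is over the empty index set, hence
  a point mass, and the image measure is the point mass at \<open>1\<close>.
\<close>

definition hyperplane_volume :: "(real^'n::{finite,linorder}) measure" where
  "hyperplane_volume = distr (Pi\<^sub>M (UNIV - {last_ix}) (\<lambda>_. lborel)) borel
     (\<lambda>x. \<chi> i. if i = last_ix then 1 - (\<Sum>j\<in>UNIV - {last_ix}. x j) else x i)"

definition dirichlet_law :: "real^'n::{finite,linorder} \<Rightarrow> (real^'n::{finite,linorder}) measure" where
  "dirichlet_law a = density hyperplane_volume
     (\<lambda>x. ennreal (indicator prob_simplex x *
        (Gamma (\<Sum>i\<in>UNIV. a $ i) * (\<Prod>i\<in>UNIV. x $ i powr (a $ i - 1) / Gamma (a $ i)))))"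


text \<open>\<open>left_prod A n = A n ** A (n - 1) ** \<dots> ** A 1\<close>; the entry \<open>A 0\<close> is not used.\<close>

primrec left_prod :: "(nat \<Rightarrow> real^'n::finite^'n) \<Rightarrow> nat \<Rightarrow> real^'n^'n" where
  "left_prod A 0 = mat 1"
| "left_prod A (Suc n) = A (Suc n) ** left_prod A n"

definition as_limit ::
  "'b measure \<Rightarrow> (nat \<Rightarrow> 'b \<Rightarrow> real^'n::finite^'n) \<Rightarrow> ('b \<Rightarrow> real^'n^'n) \<Rightarrow> bool" where
  "as_limit N Xs L \<longleftrightarrow> L \<in> borel_measurable N \<and>
     (AE \<omega> in N. (\<lambda>n. left_prod (\<lambda>k. Xs k \<omega>) n) \<longlonglongrightarrow> L \<omega>)"

text \<open>
  Membership of a law \<open>\<mu>\<close> is a property of the law of an i.i.d. sequence \<open>X(1), X(2), \<dots>\<close> with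
  marginal \<open>\<mu>\<close>; it is expressed for the canonical one, the coordinate process on the product space.
\<close>

definition dirichlet_class :: "(real^'n::{finite,linorder}^'n::{finite,linorder}) measure set" where
  "dirichlet_class = {\<mu>. prob_space \<mu> \<and> sets \<mu> = sets borel \<and> (AE A in \<mu>. A \<in> stochastic_mats) \<and>
     (\<exists>L. as_limit (Pi\<^sub>M {1::nat..} (\<lambda>_. \<mu>)) (\<lambda>n \<omega>. \<omega> n) L \<and>
        (AE \<omega> in Pi\<^sub>M {1::nat..} (\<lambda>_. \<mu>). \<forall>i j. row i (L \<omega>) = row j (L \<omega>)) \<and>
        (\<exists>a\<in>pos_vecs. \<forall>i.
           distr (Pi\<^sub>M {1::nat..} (\<lambda>_. \<mu>)) borel (\<lambda>\<omega>. row i (L \<omega>)) = dirichlet_law a))}"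

text \<open>
  \<open>M\<close> need not carry a vector \<open>V\<close> independent of \<open>X\<close>, so \<open>V\<close> is taken to be the first coordinate on
  the product of its law with \<open>M\<close>.
\<close>

definition gamma_invariant ::
  "'a measure \<Rightarrow> ('a \<Rightarrow> real^'n::finite^'n) \<Rightarrow> real^'n \<Rightarrow> bool" where
  "gamma_invariant M X t \<longleftrightarrow> t \<in> pos_vecs \<and>
     distr (gamma_vec_law t \<Otimes>\<^sub>M M) borel (\<lambda>(v, \<omega>). v v* X \<omega>) = gamma_vec_law t"

text \<open>
  The library's \<open>indep_var\<close> requires both variables to have the same type, so independence of a
  random vector and a random matrix is stated for the generated sigma-algebras.
\<close>

definition indep_rvs ::
  "'a measure \<Rightarrow> ('a \<Rightarrow> 'c::topological_space) \<Rightarrow> ('a \<Rightarrow> 'd::topological_space) \<Rightarrow> bool" where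
  "indep_rvs M Y X \<longleftrightarrow> Y \<in> borel_measurable M \<and> X \<in> borel_measurable M \<and>
     prob_space.indep_set M {Y -` A \<inter> space M | A. A \<in> sets borel}
                            {X -` B \<inter> space M | B. B \<in> sets borel}"

definition reaches_positive :: "'b measure \<Rightarrow> (nat \<Rightarrow> 'b \<Rightarrow> real^'n::finite^'n) \<Rightarrow> bool" where
  "reaches_positive N Xs \<longleftrightarrow>
     (\<exists>m\<ge>1. 0 < measure N {\<omega> \<in> space N. left_prod (\<lambda>k. Xs k \<omega>) m \<in> pos_stochastic_mats})"

end

theory Submission
  imports Defs
begin

text \<open>
  If \<open>V\<close> has independent gamma components, then its coordinate sum and the normalized vector \<open>V / |V|\<close>
  are independent, with a gamma and a Dirichlet law. A limit \<open>L\<close> of the left products with equal rows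
  satisfies \<open>v L = |v| r\<close>, where \<open>r\<close> is the common row; as every invariant law of row vectors is
  preserved by \<open>L\<close>, normalizing shows that \<open>r\<close> has the law of \<open>V / |V|\<close> for each invariant \<open>V\<close>. This
  gives both the Dirichlet law of the limit and the uniqueness of the invariant law on the simplex.
  Conversely, splitting off the factor \<open>X(1)\<close> shows that the law of \<open>r\<close> is invariant, and multiplying
  by an independent gamma variable turns the Dirichlet law into a gamma vector. Convergence follows from
  positivity because a left factor \<open>A\<close> shrinks the oscillation of every column by \<open>1 - min A\<close>, so that
  the expected oscillation decays geometrically; positivity follows from convergence because a Dirichlet
  vector has positive entries.
\<close>

section \<open>Gamma and Dirichlet laws\<close>

text \<open>Laws are compared through integrals of nonnegative functions, so no integrability has to
  be checked; the independence of \<open>|V|\<close> and \<open>V / |V|\<close> accordingly takes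
  the form of an iterated integral.

  The obstacle is that invariance under \<open>X\<close> controls \<open>V X(n,1)\<close> only in
  distribution, whereas the limit is almost sure. The two ends of the product settle this. New
  factors enter on the left, where they average rows and keep the column ranges nested, so that
  information about the expected oscillation alone already yields pathwise convergence. The i.i.d.
  law, on the other hand, is unchanged when an independent factor is inserted on the right, and this
  gives the equation satisfied by the law of the limit.

  Distinct parameters are never compared: each \<open>t\<close> as in [C1] is shown separately to
  describe the law of one and the same row.\<close>

lemma PiM_density:
  fixes f :: "'i \<Rightarrow> 'a \<Rightarrow> ennreal"
  assumes "product_sigma_finite M" "product_sigma_finite (\<lambda>i. density (M i) (f i))" "finite I"
    and f: "\<And>i. f i \<in> borel_measurable (M i)"
  shows "Pi\<^sub>M I (\<lambda>i. density (M i) (f i)) = density (Pi\<^sub>M I M) (\<lambda>x. \<Prod>i\<in>I. f i (x i))"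
proof -
  interpret M: product_sigma_finite M by fact
  interpret D: product_sigma_finite "\<lambda>i. density (M i) (f i)" by fact
  note f[measurable]
  show ?thesis
  proof (rule D.PiM_eqI[symmetric])
    show "sets (density (Pi\<^sub>M I M) (\<lambda>x. \<Prod>i\<in>I. f i (x i))) = sets (Pi\<^sub>M I (\<lambda>i. density (M i) (f i)))"
      by (auto intro!: sets_PiM_cong)
    fix A assume A: "\<And>i. i \<in> I \<Longrightarrow> A i \<in> sets (density (M i) (f i))"
    then have A': "\<And>i. i \<in> I \<Longrightarrow> A i \<in> sets (M i)" by simp
    have "emeasure (density (Pi\<^sub>M I M) (\<lambda>x. \<Prod>i\<in>I. f i (x i))) (Pi\<^sub>E I A)
      = (\<integral>\<^sup>+x. (\<Prod>i\<in>I. f i (x i)) * indicator (Pi\<^sub>E I A) x \<partial>Pi\<^sub>M I M)"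
      using A' \<open>finite I\<close> by (intro emeasure_density) (auto intro!: sets_PiM_I_finite)
    \<comment> \<open>The indicator of a box is the product of the indicators of its sides, so the
      integrand splits into factors of one variable each.\<close>
    also have "\<dots> = (\<integral>\<^sup>+x. (\<Prod>i\<in>I. f i (x i) * indicator (A i) (x i)) \<partial>Pi\<^sub>M I M)"
      using \<open>finite I\<close>
      by (intro nn_integral_cong)
         (auto simp: prod.distrib indicator_def space_PiM PiE_iff prod_zero_iff split: if_splits)
    also have "\<dots> = (\<Prod>i\<in>I. \<integral>\<^sup>+y. f i y * indicator (A i) y \<partial>M i)"
      using A' \<open>finite I\<close> by (intro M.product_nn_integral_prod) auto
    also have "\<dots> = (\<Prod>i\<in>I. emeasure (density (M i) (f i)) (A i))"
      using A' by (intro prod.cong) (auto simp: emeasure_density)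
    finally show "emeasure (density (Pi\<^sub>M I M) (\<lambda>x. \<Prod>i\<in>I. f i (x i))) (Pi\<^sub>E I A)
      = (\<Prod>i\<in>I. emeasure (density (M i) (f i)) (A i))" .
  qed fact
qed

interpretation lborel_product: product_sigma_finite "\<lambda>_. lborel :: real measure" ..

text \<open>Supplies the Jacobian \<open>s ^ (d - 1)\<close> of the polar decomposition. Boxes
  determine the product measure, which reduces the claim to scaling in one dimension; an empty
  \<open>I\<close>, the case \<open>d = 1\<close>, gives the factor 1.\<close>

lemma nn_integral_PiM_lborel_scale:
  fixes c :: real
  assumes I: "finite I" and c: "0 < c" and F[measurable]: "F \<in> borel_measurable (Pi\<^sub>M I (\<lambda>_. lborel))"
  shows "(\<integral>\<^sup>+x. F x \<partial>Pi\<^sub>M I (\<lambda>_. lborel))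
    = ennreal (c ^ card I) * (\<integral>\<^sup>+x. F (\<lambda>i\<in>I. c * x i) \<partial>Pi\<^sub>M I (\<lambda>_. lborel))"
proof -
  let ?P = "Pi\<^sub>M I (\<lambda>_. lborel :: real measure)"
  let ?S = "\<lambda>x. \<lambda>i\<in>I. c * x i"
  have S[measurable]: "?S \<in> ?P \<rightarrow>\<^sub>M ?P" by measurable
  \<comment> \<open>The image of Lebesgue measure under \<open>?S\<close> is too small by the factor
    \<open>c ^ card I\<close>; the constant density restores it.\<close>
  have "density (distr ?P ?P ?S) (\<lambda>_. ennreal (c ^ card I)) = ?P"
  proof (rule lborel_product.PiM_eqI)
    fix A :: "'a \<Rightarrow> real set" assume A: "\<And>i. i \<in> I \<Longrightarrow> A i \<in> sets lborel"
    have box: "Pi\<^sub>E I A \<in> sets ?P" using A I by (auto intro!: sets_PiM_I_finite)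
    have m: "(\<lambda>y. c * y) -` A i \<in> sets borel" if "i \<in> I" for i
      using A[OF that] measurable_sets[of "\<lambda>y. c * y" borel borel "A i"] by simp
    have one: "emeasure lborel (A i) = ennreal c * emeasure lborel ((\<lambda>y. c * y) -` A i)" if "i \<in> I" for i
    proof -
      have "emeasure lborel (A i) = (\<integral>\<^sup>+y. indicator (A i) y \<partial>lborel)"
        using A[OF that] by simp
      also have "\<dots> = \<bar>c\<bar> * (\<integral>\<^sup>+y. indicator (A i) (0 + c * y) \<partial>lborel)"
        using A[OF that] c by (intro nn_integral_real_affine) auto
      also have "(\<integral>\<^sup>+y. indicator (A i) (0 + c * y) \<partial>lborel)
          = (\<integral>\<^sup>+y. indicator ((\<lambda>y. c * y) -` A i) y \<partial>lborel)"
        by (intro nn_integral_cong) (auto simp: indicator_def)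
      also have "\<dots> = emeasure lborel ((\<lambda>y. c * y) -` A i)" using m[OF that] by simp
      finally show ?thesis using c by simp
    qed
    have "emeasure (density (distr ?P ?P ?S) (\<lambda>_. ennreal (c ^ card I))) (Pi\<^sub>E I A)
        = ennreal (c ^ card I) * emeasure ?P (?S -` Pi\<^sub>E I A \<inter> space ?P)"
      using box by (simp add: emeasure_density nn_integral_cmult emeasure_distr)
    also have "?S -` Pi\<^sub>E I A \<inter> space ?P = (\<Pi>\<^sub>E i\<in>I. (\<lambda>y. c * y) -` A i)"
      by (auto simp: space_PiM PiE_iff)
    also have "emeasure ?P \<dots> = (\<Prod>i\<in>I. emeasure lborel ((\<lambda>y. c * y) -` A i))"
      using m I by (intro lborel_product.emeasure_PiM) auto
    also have "ennreal (c ^ card I) * \<dots> = (\<Prod>i\<in>I. ennreal c * emeasure lborel ((\<lambda>y. c * y) -` A i))"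
      using c by (simp add: prod.distrib ennreal_power)
    also have "\<dots> = (\<Prod>i\<in>I. emeasure lborel (A i))"
      using one by (intro prod.cong) auto
    finally show "emeasure (density (distr ?P ?P ?S) (\<lambda>_. ennreal (c ^ card I))) (Pi\<^sub>E I A)
      = (\<Prod>i\<in>I. emeasure lborel (A i))" .
  qed (use I in auto)
  then have "(\<integral>\<^sup>+x. F x \<partial>?P) = (\<integral>\<^sup>+x. F x \<partial>density (distr ?P ?P ?S) (\<lambda>_. ennreal (c ^ card I)))"
    by simp
  also have "\<dots> = ennreal (c ^ card I) * (\<integral>\<^sup>+x. F (?S x) \<partial>?P)"
    by (simp add: nn_integral_density nn_integral_cmult nn_integral_distr)
  finally show ?thesis .
qed

section \<open>Gamma densities and coordinates on the hyperplane of total 1\<close>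

definition gamma_density :: "real \<Rightarrow> real \<Rightarrow> real" where
  "gamma_density u x = (if 0 < x then x powr (u - 1) * exp (- x) / Gamma u else 0)"

lemma gamma_density_measurable[measurable]: "gamma_density u \<in> borel_measurable borel"
  unfolding gamma_density_def by measurable

lemma gamma_density_nonneg: "0 < u \<Longrightarrow> 0 \<le> gamma_density u x"
  by (simp add: gamma_density_def Gamma_real_pos less_imp_le)

lemma gamma_law_eq: "gamma_law u = density lborel (\<lambda>x. ennreal (gamma_density u x))"
  by (simp add: gamma_law_def gamma_density_def)

lemma prob_space_gamma_law:
  assumes "0 < u"
  shows "prob_space (gamma_law u)"
proof
  have "emeasure (gamma_law u) (space (gamma_law u)) = (\<integral>\<^sup>+x. ennreal (gamma_density u x) \<partial>lborel)"
    by (simp add: gamma_law_eq emeasure_density)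
  \<comment> \<open>The half-line is closed here and open in \<open>gamma_density\<close>; at 0 both
    integrands vanish because \<open>0 powr (u - 1) = 0\<close>.\<close>
  also have "\<dots> = (\<integral>\<^sup>+x. ennreal (1 / Gamma u) * ennreal (indicator {0..} x * x powr (u - 1) / exp x) \<partial>lborel)"
    using Gamma_real_pos[OF assms]
    by (intro nn_integral_cong)
       (auto simp: gamma_density_def indicator_def exp_minus field_simps ennreal_mult[symmetric])
  also have "\<dots> = ennreal (1 / Gamma u) * ennreal (Gamma u)"
    unfolding Gamma_conv_nn_integral_real[OF assms] by (rule nn_integral_cmult) measurable
  also have "\<dots> = 1" using Gamma_real_pos[OF assms] by (simp add: ennreal_mult[symmetric])
  finally show "emeasure (gamma_law u) (space (gamma_law u)) = 1" .
qed

definition hyperplane_point :: "('n \<Rightarrow> real) \<Rightarrow> real^'n::{finite,linorder}" where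
  "hyperplane_point x = (\<chi> i. if i = last_ix then 1 - (\<Sum>j\<in>UNIV - {last_ix}. x j) else x i)"

lemma hyperplane_point_measurable[measurable]:
  "hyperplane_point \<in> Pi\<^sub>M (UNIV - {last_ix::'n::{finite,linorder}}) (\<lambda>_. lborel) \<rightarrow>\<^sub>M borel"
proof (subst borel_measurable_euclidean_space, intro ballI)
  fix b :: "real^'n::{finite,linorder}" assume "b \<in> Basis"
  then obtain i where b: "b = axis i 1" by (auto simp: Basis_vec_def)
  show "(\<lambda>x. hyperplane_point x \<bullet> b) \<in> borel_measurable (Pi\<^sub>M (UNIV - {last_ix}) (\<lambda>_. lborel))"
    unfolding b inner_axis hyperplane_point_def by (cases "i = last_ix") (simp_all)
qed

lemma sum_hyperplane_point: "(\<Sum>i\<in>UNIV. hyperplane_point x $ i) = 1"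
proof -
  have "(\<Sum>i\<in>UNIV. hyperplane_point x $ i)
      = hyperplane_point x $ last_ix + (\<Sum>i\<in>UNIV - {last_ix}. hyperplane_point x $ i)"
    by (rule sum.remove) auto
  then show ?thesis by (simp add: hyperplane_point_def)
qed

lemma vec_lambda_measurable[measurable]:
  "(\<lambda>x. (\<chi> i. x i) :: real^'n::finite) \<in> Pi\<^sub>M UNIV (\<lambda>_. borel) \<rightarrow>\<^sub>M borel"
proof (subst borel_measurable_euclidean_space, intro ballI)
  fix b :: "real^'n" assume "b \<in> Basis"
  then obtain i where b: "b = axis i 1" by (auto simp: Basis_vec_def)
  show "(\<lambda>x. (\<chi> i. x i) \<bullet> b) \<in> borel_measurable (Pi\<^sub>M UNIV (\<lambda>_. borel))"
    unfolding b inner_axis by simp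
qed

lemma vec_nth_measurable[measurable]: "(\<lambda>x :: 'a::real_normed_vector^'n::finite. x $ i) \<in> borel \<rightarrow>\<^sub>M borel"
  by (intro borel_measurable_continuous_onI continuous_intros)

section \<open>Polar decomposition of gamma vectors\<close>

definition dirichlet_density :: "real^'n::finite \<Rightarrow> real^'n \<Rightarrow> real" where
  "dirichlet_density a x = indicator prob_simplex x *
     (Gamma (\<Sum>i\<in>UNIV. a $ i) * (\<Prod>i\<in>UNIV. x $ i powr (a $ i - 1) / Gamma (a $ i)))"

lemma prob_simplex_measurable[measurable]: "prob_simplex \<in> sets borel"
  unfolding prob_simplex_def by measurable

lemma dirichlet_density_measurable[measurable]: "dirichlet_density a \<in> borel_measurable borel"
  unfolding dirichlet_density_def by measurable

lemma nn_integral_dirichlet_law: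
  assumes [measurable]: "f \<in> borel_measurable borel"
  shows "(\<integral>\<^sup>+x. f x \<partial>dirichlet_law a) = (\<integral>\<^sup>+x. ennreal (dirichlet_density a (hyperplane_point x)) *
    f (hyperplane_point x) \<partial>Pi\<^sub>M (UNIV - {last_ix}) (\<lambda>_. lborel))"
proof -
  have "dirichlet_law a = density (distr (Pi\<^sub>M (UNIV - {last_ix}) (\<lambda>_. lborel)) borel hyperplane_point)
      (\<lambda>x. ennreal (dirichlet_density a x))"
    by (simp add: dirichlet_law_def hyperplane_volume_def hyperplane_point_def[abs_def] dirichlet_density_def)
  then show ?thesis by (simp add: nn_integral_density nn_integral_distr)
qed

lemma sum_pos_vecs: "a \<in> pos_vecs \<Longrightarrow> 0 < (\<Sum>i\<in>UNIV. a $ i)"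
  unfolding pos_vecs_def by (intro sum_pos) auto

text \<open>The exponents of \<open>s\<close> add up to
  \<open>(\<Sum>i\<in>UNIV. a $ i) - d\<close>, the Jacobian contributes \<open>d - 1\<close>, and
  the exponentials merge into \<open>exp (- s)\<close> since \<open>y\<close> has total 1. The
  factor \<open>Gamma\<close> of the total parameter cancels between the two densities. The identity
  extends beyond the simplex because both sides vanish once a coordinate is not positive.\<close>

lemma prod_gamma_density_scaled:
  fixes a y :: "real^'n::finite"
  assumes a: "a \<in> pos_vecs" and s: "0 < s" and y: "(\<Sum>i\<in>UNIV. y $ i) = 1"
  shows "s ^ (CARD('n) - 1) * (\<Prod>i\<in>UNIV. gamma_density (a $ i) (s * y $ i))
    = gamma_density (\<Sum>i\<in>UNIV. a $ i) s * dirichlet_density a y"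
proof (cases "\<forall>i. 0 < y $ i")
  case False
  then obtain i where i: "y $ i \<le> 0" by (auto simp: not_less)
  then have "gamma_density (a $ i) (s * y $ i) = 0"
    using s by (simp add: gamma_density_def zero_less_mult_iff)
  moreover have "dirichlet_density a y = 0"
  \<comment> \<open>Since \<open>0 powr r = 0\<close> for every \<open>r\<close>, including
    \<open>r = 0\<close>, the Dirichlet density vanishes on the boundary of the simplex for all
    parameters.\<close>
  proof (cases "y $ i = 0")
    case True then show ?thesis by (auto simp: dirichlet_density_def intro!: bexI[of _ i])
  next
    case False
    then have "y \<notin> prob_simplex" using i by (auto simp: prob_simplex_def intro!: exI[of _ i])
    then show ?thesis by (simp add: dirichlet_density_def)
  qed
  ultimately show ?thesis by (auto intro!: bexI[of _ i])
next
  case True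
  let ?A = "\<Sum>i\<in>UNIV. a $ i"
  have A: "0 < ?A" using sum_pos_vecs[OF a] .
  have G: "Gamma ?A > 0" using Gamma_real_pos[OF A] .
  have simplex: "y \<in> prob_simplex" using True y by (simp add: prob_simplex_def less_imp_le)
  have "(\<Prod>i\<in>UNIV. gamma_density (a $ i) (s * y $ i))
      = (\<Prod>i\<in>UNIV. s powr (a $ i - 1) * exp (- (s * y $ i)) * (y $ i powr (a $ i - 1) / Gamma (a $ i)))"
    using s True by (intro prod.cong) (auto simp: gamma_density_def powr_mult less_imp_le)
  also have "\<dots> = (\<Prod>i\<in>UNIV. s powr (a $ i - 1)) * (\<Prod>i\<in>UNIV. exp (- (s * y $ i)))
      * (\<Prod>i\<in>UNIV. y $ i powr (a $ i - 1) / Gamma (a $ i))"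
    by (simp only: prod.distrib)
  also have "(\<Prod>i\<in>UNIV. s powr (a $ i - 1)) = s powr (?A - CARD('n))"
    using s by (simp add: powr_sum[symmetric] sum_subtractf)
  also have "(\<Prod>i\<in>UNIV. exp (- (s * y $ i))) = exp (- s)"
    using y by (simp add: exp_sum[symmetric] sum_negf sum_distrib_left[symmetric])
  finally have *: "(\<Prod>i\<in>UNIV. gamma_density (a $ i) (s * y $ i)) = s powr (?A - CARD('n)) * exp (- s)
      * (\<Prod>i\<in>UNIV. y $ i powr (a $ i - 1) / Gamma (a $ i))" .
  have "s ^ (CARD('n) - 1) * s powr (?A - CARD('n)) = s powr (?A - 1)"
  proof -
    have "s ^ (CARD('n) - 1) = s powr (real CARD('n) - 1)"
      using s by (simp add: powr_realpow[symmetric] of_nat_diff Suc_leI)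
    then show ?thesis by (simp add: powr_add[symmetric])
  qed
  then show ?thesis
    unfolding * using s simplex G
    by (simp add: gamma_density_def dirichlet_density_def mult.assoc[symmetric])
qed

text \<open>This is the statement that a gamma vector is an independent product of a gamma radius
  and a Dirichlet direction. The last coordinate is traded for the total \<open>s\<close>, and the
  remaining ones are then scaled by \<open>s\<close>; \<open>prod_gamma_density_scaled\<close>
  separates the resulting density.\<close>

lemma nn_integral_gamma_vec_law:
  fixes a :: "real^'n::{finite,linorder}"
  assumes a: "a \<in> pos_vecs" and f[measurable]: "f \<in> borel_measurable borel"
  shows "(\<integral>\<^sup>+v. f v \<partial>gamma_vec_law a)
    = (\<integral>\<^sup>+s. (\<integral>\<^sup>+x. f (s *\<^sub>R x) \<partial>dirichlet_law a) \<partial>gamma_law (\<Sum>i\<in>UNIV. a $ i))"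
proof -
  let ?J = "UNIV - {last_ix :: 'n}"
  let ?A = "\<Sum>i\<in>UNIV. a $ i"
  define F :: "('n \<Rightarrow> real) \<Rightarrow> ennreal" where
    "F x = f (\<chi> i. x i) * ennreal (\<Prod>i\<in>UNIV. gamma_density (a $ i) (x i))" for x
  define R where "R s x = x(last_ix := s - (\<Sum>j\<in>?J. x j))" for s :: real and x :: "'n \<Rightarrow> real"
  have a_pos: "0 < a $ i" for i using a by (simp add: pos_vecs_def)
  have psf: "product_sigma_finite (\<lambda>i. gamma_law (a $ i))"
    using a_pos by (intro product_sigma_finite.intro prob_space_imp_sigma_finite prob_space_gamma_law)
  have ins: "insert last_ix ?J = UNIV" by auto
  have F_meas[measurable]: "F \<in> borel_measurable (Pi\<^sub>M UNIV (\<lambda>_. lborel))"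
    unfolding F_def by measurable
  have R_meas[measurable]: "(\<lambda>(x, s). R s x) \<in> Pi\<^sub>M ?J (\<lambda>_. lborel) \<Otimes>\<^sub>M lborel \<rightarrow>\<^sub>M Pi\<^sub>M UNIV (\<lambda>_. lborel)"
  proof -
    have "(\<lambda>p. (fst p)(last_ix := snd p - (\<Sum>j\<in>?J. fst p j))) \<in> Pi\<^sub>M ?J (\<lambda>_. lborel) \<Otimes>\<^sub>M lborel
       \<rightarrow>\<^sub>M Pi\<^sub>M (insert last_ix ?J) (\<lambda>_. lborel :: real measure)"
      by measurable
    then show ?thesis by (simp add: ins R_def case_prod_unfold)
  qed
  have "(\<integral>\<^sup>+v. f v \<partial>gamma_vec_law a) = (\<integral>\<^sup>+x. f (\<chi> i. x i) \<partial>Pi\<^sub>M UNIV (\<lambda>i. gamma_law (a $ i)))"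
  proof -
    have "(\<lambda>x. (\<chi> i. x i) :: real^'n::{finite,linorder}) \<in> Pi\<^sub>M UNIV (\<lambda>i. gamma_law (a $ i)) \<rightarrow>\<^sub>M borel"
      using vec_lambda_measurable
      by (subst measurable_cong_sets[OF sets_PiM_cong[OF refl] refl]) (auto simp: gamma_law_def)
    then show ?thesis unfolding gamma_vec_law_def by (subst nn_integral_distr) auto
  qed
  also have "Pi\<^sub>M UNIV (\<lambda>i. gamma_law (a $ i))
      = density (Pi\<^sub>M UNIV (\<lambda>_. lborel)) (\<lambda>x. \<Prod>i\<in>UNIV. ennreal (gamma_density (a $ i) (x i)))"
    unfolding gamma_law_eq
    by (rule PiM_density) (use psf in \<open>auto simp: gamma_law_eq intro: lborel_product.product_sigma_finite_axioms\<close>)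
  also have "(\<integral>\<^sup>+x. f (\<chi> i. x i) \<partial>density (Pi\<^sub>M UNIV (\<lambda>_. lborel)) (\<lambda>x. \<Prod>i\<in>UNIV. ennreal (gamma_density (a $ i) (x i))))
      = (\<integral>\<^sup>+x. F x \<partial>Pi\<^sub>M UNIV (\<lambda>_. lborel))"
    by (subst nn_integral_density) (auto simp: F_def[abs_def] prod_ennreal gamma_density_nonneg a_pos mult.commute)
  also have "\<dots> = (\<integral>\<^sup>+x. (\<integral>\<^sup>+y. F (x(last_ix := y)) \<partial>lborel) \<partial>Pi\<^sub>M ?J (\<lambda>_. lborel))"
    using lborel_product.product_nn_integral_insert[of ?J last_ix F] by (simp add: ins)
  \<comment> \<open>With the other coordinates fixed, passing from the last coordinate to the total
    is a translation, so no Jacobian appears.\<close>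
  also have "\<dots> = (\<integral>\<^sup>+x. (\<integral>\<^sup>+s. F (R s x) \<partial>lborel) \<partial>Pi\<^sub>M ?J (\<lambda>_. lborel))"
  proof (rule nn_integral_cong)
    fix x :: "'n \<Rightarrow> real" assume x: "x \<in> space (Pi\<^sub>M ?J (\<lambda>_. lborel))"
    have "(\<lambda>y. x(last_ix := y)) \<in> borel \<rightarrow>\<^sub>M Pi\<^sub>M (insert last_ix ?J) (\<lambda>_. lborel)"
      using measurable_component_update[OF x, of last_ix] by simp
    then have "(\<lambda>y. F (x(last_ix := y))) \<in> borel_measurable borel"
      unfolding ins by measurable
    then show "(\<integral>\<^sup>+y. F (x(last_ix := y)) \<partial>lborel) = (\<integral>\<^sup>+s. F (R s x) \<partial>lborel)"
      using nn_integral_real_affine[of "\<lambda>y. F (x(last_ix := y))" 1 "- (\<Sum>j\<in>?J. x j)"]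
      by (simp add: R_def)
  qed
  also have "(\<integral>\<^sup>+x. (\<integral>\<^sup>+s. F (R s x) \<partial>lborel) \<partial>Pi\<^sub>M ?J (\<lambda>_. lborel))
      = (\<integral>\<^sup>+s. (\<integral>\<^sup>+x. F (R s x) \<partial>Pi\<^sub>M ?J (\<lambda>_. lborel)) \<partial>lborel)"
  proof (rule pair_sigma_finite.Fubini'[symmetric])
    show "pair_sigma_finite (Pi\<^sub>M ?J (\<lambda>_. lborel :: real measure)) (lborel :: real measure)"
      by (intro pair_sigma_finite.intro lborel_product.sigma_finite lborel.sigma_finite_measure_axioms) auto
    show "(\<lambda>(x, s). F (R s x)) \<in> borel_measurable (Pi\<^sub>M ?J (\<lambda>_. lborel) \<Otimes>\<^sub>M lborel)"
      using measurable_compose[OF R_meas F_meas] by (simp add: case_prod_unfold)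
  qed
  also have "\<dots> = (\<integral>\<^sup>+s. ennreal (gamma_density ?A s) * (\<integral>\<^sup>+x. f (s *\<^sub>R x) \<partial>dirichlet_law a) \<partial>lborel)"
  proof (rule nn_integral_cong)
    fix s :: real
    have R_meas1[measurable]: "(\<lambda>x. R s x) \<in> Pi\<^sub>M ?J (\<lambda>_. lborel) \<rightarrow>\<^sub>M Pi\<^sub>M UNIV (\<lambda>_. lborel)"
      using measurable_compose[OF measurable_Pair[OF measurable_ident measurable_const] R_meas, of s] by simp
    show "(\<integral>\<^sup>+x. F (R s x) \<partial>Pi\<^sub>M ?J (\<lambda>_. lborel))
        = ennreal (gamma_density ?A s) * (\<integral>\<^sup>+x. f (s *\<^sub>R x) \<partial>dirichlet_law a)"
    proof (cases "0 < s")
      case False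
      \<comment> \<open>The coordinates of \<open>R s x\<close> sum to \<open>s\<close>, so a total
        that is not positive forces a coordinate that is not positive, where the gamma density is
        0.\<close>
      have "F (R s x) = 0" for x
      proof -
        have "\<not> (\<forall>i. 0 < R s x i)"
        proof
          assume pos: "\<forall>i. 0 < R s x i"
          have "(\<Sum>i\<in>UNIV. R s x i) = R s x last_ix + (\<Sum>i\<in>?J. R s x i)" by (rule sum.remove) auto
          also have "\<dots> = s" by (simp add: R_def)
          finally show False using pos False sum_pos[of UNIV "R s x"] by auto
        qed
        then obtain i where "\<not> 0 < R s x i" by blast
        then have "gamma_density (a $ i) (R s x i) = 0" by (simp add: gamma_density_def)
        then have "(\<Prod>i\<in>UNIV. gamma_density (a $ i) (R s x i)) = 0" by (intro prod_zero) auto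
        then show ?thesis by (simp only: F_def ennreal_0 mult_zero_right)
      qed
      then show ?thesis using False by (simp add: gamma_density_def)
    next
      case True
      \<comment> \<open>Scaling the free coordinates also scales the dependent one: \<open>s\<close>
        minus \<open>s\<close> times their sum is \<open>s\<close> times the last coordinate of
        \<open>hyperplane_point x\<close>.\<close>
      have coord: "R s (\<lambda>i\<in>?J. s * x i) i = s * hyperplane_point x $ i" for x i
        by (auto simp: R_def hyperplane_point_def sum_distrib_left right_diff_distrib)
      have vec: "(\<chi> i. R s (\<lambda>i\<in>?J. s * x i) i) = s *\<^sub>R hyperplane_point x" for x
        by (simp add: coord vec_eq_iff)
      have "(\<integral>\<^sup>+x. F (R s x) \<partial>Pi\<^sub>M ?J (\<lambda>_. lborel))
          = ennreal (s ^ card ?J) * (\<integral>\<^sup>+x. F (R s (\<lambda>i\<in>?J. s * x i)) \<partial>Pi\<^sub>M ?J (\<lambda>_. lborel))"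
        using True by (intro nn_integral_PiM_lborel_scale) auto
      also have "\<dots> = (\<integral>\<^sup>+x. ennreal (s ^ card ?J) * F (R s (\<lambda>i\<in>?J. s * x i)) \<partial>Pi\<^sub>M ?J (\<lambda>_. lborel))"
        by (subst nn_integral_cmult) auto
      also have "\<dots> = (\<integral>\<^sup>+x. ennreal (gamma_density ?A s) * (ennreal (dirichlet_density a (hyperplane_point x)) *
          f (s *\<^sub>R hyperplane_point x)) \<partial>Pi\<^sub>M ?J (\<lambda>_. lborel))"
      proof (rule nn_integral_cong)
        fix x
        have "ennreal (s ^ card ?J) * ennreal (\<Prod>i\<in>UNIV. gamma_density (a $ i) (s * hyperplane_point x $ i))
          = ennreal (gamma_density ?A s) * ennreal (dirichlet_density a (hyperplane_point x))"
          using prod_gamma_density_scaled[OF a True sum_hyperplane_point, of x] True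
            gamma_density_nonneg[OF sum_pos_vecs[OF a]]
          by (simp add: ennreal_mult'[symmetric] card_Diff_singleton)
        from arg_cong[OF this, of "\<lambda>r. r * f (s *\<^sub>R hyperplane_point x)"]
        show "ennreal (s ^ card ?J) * F (R s (\<lambda>i\<in>?J. s * x i)) = ennreal (gamma_density ?A s) *
          (ennreal (dirichlet_density a (hyperplane_point x)) * f (s *\<^sub>R hyperplane_point x))"
          by (simp only: F_def vec) (simp only: coord ac_simps)
      qed
      also have "\<dots> = ennreal (gamma_density ?A s) * (\<integral>\<^sup>+x. f (s *\<^sub>R x) \<partial>dirichlet_law a)"
        by (subst nn_integral_dirichlet_law) (auto intro!: nn_integral_cmult)
      finally show ?thesis .
    qed
  qed
  also have "\<dots> = (\<integral>\<^sup>+s. (\<integral>\<^sup>+x. f (s *\<^sub>R x) \<partial>dirichlet_law a) \<partial>gamma_law ?A)"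
    unfolding gamma_law_eq nn_integral_dirichlet_law
  proof (subst nn_integral_density)
    show "(\<lambda>s. \<integral>\<^sup>+x. f (s *\<^sub>R x) \<partial>dirichlet_law a) \<in> borel_measurable lborel"
      by (subst nn_integral_dirichlet_law)
       (auto intro!: sigma_finite_measure.borel_measurable_nn_integral lborel_product.sigma_finite)
  qed auto
  finally show ?thesis .
qed

lemma distr_pair_snd:
  assumes "prob_space M" "sigma_finite_measure N"
  shows "distr (M \<Otimes>\<^sub>M N) N snd = N"
proof (intro measure_eqI)
  interpret M: prob_space M by fact
  interpret N: sigma_finite_measure N by fact
  fix A assume A: "A \<in> sets (distr (M \<Otimes>\<^sub>M N) N snd)"
  then have "snd -` A \<inter> space (M \<Otimes>\<^sub>M N) = space M \<times> A"
    by (auto simp: space_pair_measure dest: sets.sets_into_space)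
  with A show "emeasure (distr (M \<Otimes>\<^sub>M N) N snd) A = emeasure N A"
    by (simp add: emeasure_distr N.emeasure_pair_measure_Times M.emeasure_space_1)
qed simp

lemma measure_eqI_nn_integral:
  assumes "sets M = sets N" "\<And>f. f \<in> borel_measurable M \<Longrightarrow> (\<integral>\<^sup>+x. f x \<partial>M) = (\<integral>\<^sup>+x. f x \<partial>N)"
  shows "M = N"
proof (rule measure_eqI)
  fix A assume "A \<in> sets M"
  then show "emeasure M A = emeasure N A"
    using assms(1) assms(2)[of "indicator A"] by simp
qed fact

section \<open>Normalization of gamma vectors\<close>

definition normalized :: "real^'n::finite \<Rightarrow> real^'n" where
  "normalized v = (1 / (\<Sum>i\<in>UNIV. v $ i)) *\<^sub>R v"

lemma normalized_measurable[measurable]: "normalized \<in> borel_measurable borel"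
  unfolding normalized_def by measurable

lemma sets_gamma_vec_law[measurable_cong, simp]: "sets (gamma_vec_law a) = sets borel"
  by (simp add: gamma_vec_law_def)

lemma sets_dirichlet_law[measurable_cong, simp]: "sets (dirichlet_law a) = sets borel"
  by (simp add: dirichlet_law_def hyperplane_volume_def)

lemma sets_gamma_law[measurable_cong, simp]: "sets (gamma_law u) = sets borel"
  by (simp add: gamma_law_def)

lemma prob_space_gamma_vec_law:
  assumes "a \<in> pos_vecs"
  shows "prob_space (gamma_vec_law a)"
  unfolding gamma_vec_law_def
proof (rule prob_space.prob_space_distr)
  show "prob_space (Pi\<^sub>M UNIV (\<lambda>i. gamma_law (a $ i)))"
    using assms by (intro prob_space_PiM prob_space_gamma_law) (simp add: pos_vecs_def)
  show "(\<lambda>x. \<chi> i. x i) \<in> Pi\<^sub>M UNIV (\<lambda>i. gamma_law (a $ i)) \<rightarrow>\<^sub>M borel"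
    using vec_lambda_measurable
    by (subst measurable_cong_sets[OF sets_PiM_cong[OF refl] refl]) auto
qed

lemma AE_gamma_law: "AE s in gamma_law u. 0 < s"
  unfolding gamma_law_def by (subst AE_density) auto

text \<open>No estimate of the boundary is required: the density itself is 0 at a vanishing
  coordinate, by the convention \<open>0 powr r = 0\<close>.\<close>

lemma AE_dirichlet_law:
  "AE x in dirichlet_law a. x \<in> prob_simplex \<and> (\<forall>i. 0 < x $ i)"
proof -
  have pos: "x \<in> prob_simplex \<and> (\<forall>i. 0 < x $ i)" if "0 < ennreal (dirichlet_density a x)" for x
  proof -
    have nz: "dirichlet_density a x \<noteq> 0" using that by auto
    then have "x \<in> prob_simplex" by (auto simp: dirichlet_density_def indicator_def split: if_splits)
    moreover have "x $ i \<noteq> 0" for i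
      using nz by (auto simp: dirichlet_density_def)
    ultimately show ?thesis unfolding prob_simplex_def by (metis (mono_tags, lifting) mem_Collect_eq less_le)
  qed
  have eq: "dirichlet_law a = density hyperplane_volume (\<lambda>x. ennreal (dirichlet_density a x))"
    by (simp add: dirichlet_law_def dirichlet_density_def)
  have meas: "(\<lambda>x. ennreal (dirichlet_density a x)) \<in> borel_measurable hyperplane_volume"
    by (simp add: hyperplane_volume_def)
  show ?thesis unfolding eq AE_density[OF meas] using pos by (intro AE_I2) blast
qed

text \<open>In the polar form, normalizing cancels the positive radius; the outer integral is then
  that of a constant against a probability law.\<close>

lemma distr_normalized_gamma_vec_law:
  assumes a: "a \<in> pos_vecs"
  shows "distr (gamma_vec_law a) borel normalized = dirichlet_law a"
proof (rule measure_eqI_nn_integral)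
  fix f :: "_ \<Rightarrow> ennreal" assume "f \<in> borel_measurable (distr (gamma_vec_law a) borel normalized)"
  then have [measurable]: "f \<in> borel_measurable borel" by simp
  interpret g: prob_space "gamma_law (\<Sum>i\<in>UNIV. a $ i)"
    by (rule prob_space_gamma_law[OF sum_pos_vecs[OF a]])
  have "(\<integral>\<^sup>+v. f v \<partial>distr (gamma_vec_law a) borel normalized)
      = (\<integral>\<^sup>+s. (\<integral>\<^sup>+x. f (normalized (s *\<^sub>R x)) \<partial>dirichlet_law a) \<partial>gamma_law (\<Sum>i\<in>UNIV. a $ i))"
    by (simp add: nn_integral_distr nn_integral_gamma_vec_law[OF a])
  also have "\<dots> = (\<integral>\<^sup>+s. (\<integral>\<^sup>+x. f x \<partial>dirichlet_law a) \<partial>gamma_law (\<Sum>i\<in>UNIV. a $ i))"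
  proof (rule nn_integral_cong_AE)
    show "AE s in gamma_law (\<Sum>i\<in>UNIV. a $ i). (\<integral>\<^sup>+x. f (normalized (s *\<^sub>R x)) \<partial>dirichlet_law a)
        = (\<integral>\<^sup>+x. f x \<partial>dirichlet_law a)"
      using AE_gamma_law
    proof eventually_elim
      case (elim s)
      show ?case
      proof (rule nn_integral_cong_AE)
        show "AE x in dirichlet_law a. f (normalized (s *\<^sub>R x)) = f x"
          using AE_dirichlet_law
        proof eventually_elim
          case (elim x)
          with \<open>0 < s\<close> show ?case
            by (simp add: normalized_def prob_simplex_def sum_distrib_left[symmetric])
        qed
      qed
    qed
  qed
  also have "\<dots> = (\<integral>\<^sup>+x. f x \<partial>dirichlet_law a)" by (simp add: g.emeasure_space_1)
  finally show "(\<integral>\<^sup>+v. f v \<partial>distr (gamma_vec_law a) borel normalized) = (\<integral>\<^sup>+x. f x \<partial>dirichlet_law a)" .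
qed simp

text \<open>The law of \<open>normalized v\<close> excludes total 0 but cannot see the sign, as
  \<open>v\<close> and \<open>- v\<close> have the same normalization. The sign is read off from the
  positive radius in the polar form.\<close>

lemma AE_gamma_vec_law:
  fixes a :: "real^'n::{finite,linorder}"
  assumes a: "a \<in> pos_vecs"
  shows "AE v in gamma_vec_law a. 0 < (\<Sum>i\<in>UNIV. v $ i)"
proof -
  have "AE v in gamma_vec_law a. normalized v \<in> prob_simplex \<and> (\<forall>i. 0 < normalized v $ i)"
  proof -
    have "normalized \<in> gamma_vec_law a \<rightarrow>\<^sub>M borel" by measurable
    moreover have "AE v in distr (gamma_vec_law a) borel normalized. v \<in> prob_simplex \<and> (\<forall>i. 0 < v $ i)"
      unfolding distr_normalized_gamma_vec_law[OF a] by (rule AE_dirichlet_law)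
    ultimately show ?thesis by (rule AE_distrD)
  qed
  moreover have "AE v in gamma_vec_law a. 0 \<le> (\<Sum>i\<in>UNIV. v $ i)"
  proof -
    have "(\<integral>\<^sup>+v. indicator {v. (\<Sum>i\<in>UNIV. v $ i) < 0} v \<partial>gamma_vec_law a)
        = (\<integral>\<^sup>+s. (\<integral>\<^sup>+x. indicator {v. (\<Sum>i\<in>UNIV. v $ i) < 0} (s *\<^sub>R x) \<partial>dirichlet_law a)
            \<partial>gamma_law (\<Sum>i\<in>UNIV. a $ i))"
      by (rule nn_integral_gamma_vec_law[OF a]) measurable
    also have "\<dots> = (\<integral>\<^sup>+s. 0 \<partial>gamma_law (\<Sum>i\<in>UNIV. a $ i))"
    proof (rule nn_integral_cong_AE)
      show "AE s in gamma_law (\<Sum>i\<in>UNIV. a $ i). (\<integral>\<^sup>+x. indicator {v. (\<Sum>i\<in>UNIV. v $ i) < 0} (s *\<^sub>R x) \<partial>dirichlet_law a)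
          = 0"
        using AE_gamma_law
      proof eventually_elim
        case (elim s)
        have "AE x in dirichlet_law a. indicator {v. (\<Sum>i\<in>UNIV. v $ i) < 0} (s *\<^sub>R x) = (0::ennreal)"
          using AE_dirichlet_law
        proof eventually_elim
          case (elim x)
          with \<open>0 < s\<close> show ?case
            by (simp add: prob_simplex_def sum_distrib_left[symmetric])
        qed
        then show ?case by (subst nn_integral_0_iff_AE) auto
      qed
    qed
    finally have "emeasure (gamma_vec_law a) {v. (\<Sum>i\<in>UNIV. v $ i) < 0} = 0" by simp
    then show ?thesis by (intro AE_I[of _ _ "{v. (\<Sum>i\<in>UNIV. v $ i) < 0}"]) (auto simp: not_le)
  qed
  ultimately show ?thesis
  proof eventually_elim
    case (elim v)
    \<comment> \<open>For total 0 the value \<open>1 / 0 = 0\<close> would make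
      \<open>normalized v\<close> the zero vector, which has no positive coordinate.\<close>
    have "(\<Sum>i\<in>UNIV. v $ i) \<noteq> 0"
      using elim(1) by (auto simp: normalized_def)
    then show ?case using elim by simp
  qed
qed


section \<open>Contraction by stochastic matrices\<close>

lemma measurable_matrix_matrix_mult[measurable (raw)]:
  fixes f g :: "'a \<Rightarrow> real^'n::finite^'n"
  assumes "f \<in> borel_measurable M" "g \<in> borel_measurable M"
  shows "(\<lambda>x. f x ** g x) \<in> borel_measurable M"
proof (rule borel_measurable_continuous_Pair[OF assms])
  show "continuous_on UNIV (\<lambda>x. fst x ** snd x :: real^'n^'n)"
    unfolding matrix_matrix_mult_def by (intro continuous_intros)
qed

lemma measurable_vector_matrix_mult[measurable (raw)]:
  fixes f :: "'a \<Rightarrow> real^'n::finite" and g :: "'a \<Rightarrow> real^'n^'n"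
  assumes "f \<in> borel_measurable M" "g \<in> borel_measurable M"
  shows "(\<lambda>x. f x v* g x) \<in> borel_measurable M"
proof (rule borel_measurable_continuous_Pair[OF assms])
  show "continuous_on UNIV (\<lambda>x. fst x v* snd x :: real^'n)"
    unfolding vector_matrix_mult_def by (intro continuous_intros)
qed

lemma measurable_row[measurable]: "row i \<in> borel_measurable (borel :: (real^'n::finite^'n) measure)"
  unfolding row_def by (intro borel_measurable_continuous_onI continuous_intros)

lemma stochastic_mats_measurable[measurable]: "stochastic_mats \<in> sets borel"
  unfolding stochastic_mats_def by measurable

lemma pos_stochastic_mats_measurable[measurable]: "pos_stochastic_mats \<in> sets borel"
  unfolding pos_stochastic_mats_def by measurable

lemma stochastic_mats_mult:
  fixes A B :: "real^'n::finite^'n"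
  assumes A: "A \<in> stochastic_mats" and B: "B \<in> stochastic_mats"
  shows "A ** B \<in> stochastic_mats"
proof -
  have "(\<Sum>j\<in>UNIV. \<Sum>k\<in>UNIV. A $ i $ k * B $ k $ j) = 1" for i
  proof -
    have "(\<Sum>j\<in>UNIV. \<Sum>k\<in>UNIV. A $ i $ k * B $ k $ j) = (\<Sum>k\<in>UNIV. \<Sum>j\<in>UNIV. A $ i $ k * B $ k $ j)"
      by (rule sum.swap)
    also have "\<dots> = (\<Sum>k\<in>UNIV. A $ i $ k * (\<Sum>j\<in>UNIV. B $ k $ j))" by (simp add: sum_distrib_left)
    finally show ?thesis using A B by (simp add: stochastic_mats_def)
  qed
  then show ?thesis using A B
    by (auto simp: stochastic_mats_def matrix_matrix_mult_def intro!: sum_nonneg)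
qed

lemma mat_1_stochastic: "(mat 1 :: real^'n::finite^'n) \<in> stochastic_mats"
  by (simp add: stochastic_mats_def mat_def)

lemma left_prod_stochastic:
  assumes "\<And>k. 1 \<le> k \<Longrightarrow> A k \<in> stochastic_mats"
  shows "left_prod A n \<in> stochastic_mats"
proof (induction n)
  case (Suc n)
  then show ?case using assms[of "Suc n"] by (simp add: stochastic_mats_mult)
qed (simp add: mat_1_stochastic)

lemma closed_stochastic_mats: "closed (stochastic_mats :: (real^'n::finite^'n) set)"
proof -
  have "closed ((\<Inter>i j. {A :: real^'n^'n. 0 \<le> A $ i $ j}) \<inter> (\<Inter>i. {A. (\<Sum>j\<in>UNIV. A $ i $ j) = 1}))"
    by (intro closed_Int closed_INT ballI closed_Collect_le closed_Collect_eq continuous_intros)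
  moreover have "(\<Inter>i j. {A :: real^'n^'n. 0 \<le> A $ i $ j}) \<inter> (\<Inter>i. {A. (\<Sum>j\<in>UNIV. A $ i $ j) = 1}) = stochastic_mats"
    by (auto simp: stochastic_mats_def)
  ultimately show ?thesis by simp
qed

lemma row_matrix_matrix_mult:
  fixes A B :: "real^'n::finite^'n"
  shows "row i (A ** B) = row i A v* B"
  by (simp add: row_def matrix_matrix_mult_def vector_matrix_mult_def vec_eq_iff mult.commute)

lemma vector_matrix_mult_equal_rows:
  fixes L :: "real^'n::finite^'n"
  assumes "\<forall>i j. row i L = row j L"
  shows "v v* L = (\<Sum>k\<in>UNIV. v $ k) *\<^sub>R row i L"
proof -
  have *: "L $ k $ j = L $ i $ j" for k j using assms by (metis row_def vec_lambda_eta)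
  show ?thesis
    unfolding vector_matrix_mult_def row_def vec_eq_iff scaleR_vec_def vec_lambda_beta real_scaleR_def
      sum_distrib_right
    using * by (metis (no_types, lifting) sum.cong)
qed

section \<open>Oscillation of columns\<close>

definition col_max :: "real^'n::finite^'n \<Rightarrow> 'n \<Rightarrow> real" where
  "col_max B j = Max (range (\<lambda>i. B $ i $ j))"

definition col_min :: "real^'n::finite^'n \<Rightarrow> 'n \<Rightarrow> real" where
  "col_min B j = Min (range (\<lambda>i. B $ i $ j))"

text \<open>It vanishes exactly when all rows agree, and so measures the distance from the matrices
  that can occur as limits.\<close>

definition spread :: "real^'n::finite^'n \<Rightarrow> real" where
  "spread B = (\<Sum>j\<in>UNIV. col_max B j - col_min B j)"

text \<open>The minorization constant of Doeblin type: every row of \<open>A\<close> gives each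
  index at least this weight.\<close>

definition min_entry :: "real^'n::finite^'n \<Rightarrow> real" where
  "min_entry A = Min (range (\<lambda>(i, j). A $ i $ j))"

lemma spread_measurable[measurable]: "spread \<in> borel_measurable borel"
  unfolding spread_def col_max_def col_min_def by measurable

lemma min_entry_measurable[measurable]: "min_entry \<in> borel_measurable borel"
proof -
  have "(\<lambda>A :: real^'n^'n. Min ((\<lambda>p. A $ fst p $ snd p) ` UNIV)) \<in> borel_measurable borel"
    by measurable
  then show ?thesis unfolding min_entry_def case_prod_unfold .
qed

lemma min_entry_le: "min_entry A \<le> A $ i $ j"
  unfolding min_entry_def by (rule Min_le) (auto intro!: image_eqI[of _ _ "(i, j)"])

lemma min_entry_pos: "(0 < min_entry A) \<longleftrightarrow> (\<forall>i j. 0 < A $ i $ j)"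
  unfolding min_entry_def by (subst Min_gr_iff) auto

lemma min_entry_nonneg: "A \<in> stochastic_mats \<Longrightarrow> 0 \<le> min_entry A"
  unfolding min_entry_def by (subst Min_ge_iff) (auto simp: stochastic_mats_def)

lemma min_entry_le_1:
  assumes "A \<in> stochastic_mats" shows "min_entry A \<le> 1"
proof -
  fix i j
  have "A $ i $ j \<le> (\<Sum>j\<in>UNIV. A $ i $ j)"
    using assms by (intro member_le_sum) (auto simp: stochastic_mats_def)
  then show ?thesis using min_entry_le[of A i j] assms by (simp add: stochastic_mats_def)
qed

lemma col_bounds: "col_min B j \<le> B $ i $ j" "B $ i $ j \<le> col_max B j"
  unfolding col_min_def col_max_def by auto

lemma col_min_le_max: "col_min B j \<le> col_max B j"
  using col_bounds[of B j] order_trans by blast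

lemma spread_nonneg: "0 \<le> spread B"
  unfolding spread_def using col_min_le_max by (intro sum_nonneg) simp

lemma col_max_attained: obtains i where "col_max B j = B $ i $ j"
proof -
  have "col_max B j \<in> range (\<lambda>i. B $ i $ j)" unfolding col_max_def by (rule Max_in) auto
  then show ?thesis using that by blast
qed

lemma col_min_attained: obtains i where "col_min B j = B $ i $ j"
proof -
  have "col_min B j \<in> range (\<lambda>i. B $ i $ j)" unfolding col_min_def by (rule Min_in) auto
  then show ?thesis using that by blast
qed

text \<open>The rows of \<open>A ** B\<close> are convex combinations of the rows of
  \<open>B\<close>.\<close>

lemma col_min_mult:
  assumes A: "A \<in> stochastic_mats"
  shows "col_min B j \<le> col_min (A ** B) j"
proof -
  obtain i where "col_min (A ** B) j = (A ** B) $ i $ j" by (rule col_min_attained)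
  moreover have "(\<Sum>k\<in>UNIV. A $ i $ k * col_min B j) \<le> (\<Sum>k\<in>UNIV. A $ i $ k * B $ k $ j)"
    using A by (intro sum_mono mult_left_mono col_bounds) (simp add: stochastic_mats_def)
  ultimately show ?thesis using A
    by (simp add: matrix_matrix_mult_def sum_distrib_right[symmetric] stochastic_mats_def)
qed

text \<open>A convex combination giving weight at least \<open>min_entry A\<close> to the minimal entry of the column.\<close>
lemma col_max_mult:
  assumes A: "A \<in> stochastic_mats"
  shows "col_max (A ** B) j \<le> col_max B j - min_entry A * (col_max B j - col_min B j)"
proof -
  obtain i where i: "col_max (A ** B) j = (A ** B) $ i $ j" by (rule col_max_attained)
  obtain l where l: "col_min B j = B $ l $ j" by (rule col_min_attained)
  have "min_entry A * (col_max B j - col_min B j) \<le> A $ i $ l * (col_max B j - B $ l $ j)"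
    unfolding l[symmetric] using col_min_le_max[of B j] by (intro mult_right_mono min_entry_le) simp
  also have "\<dots> \<le> (\<Sum>k\<in>UNIV. A $ i $ k * (col_max B j - B $ k $ j))"
    using A col_bounds[of B] by (intro member_le_sum) (auto simp: stochastic_mats_def)
  also have "\<dots> = col_max B j - (A ** B) $ i $ j"
    using A by (simp add: right_diff_distrib sum_subtractf sum_distrib_right[symmetric]
      stochastic_mats_def matrix_matrix_mult_def)
  finally show ?thesis using i by simp
qed

text \<open>The whole gain comes from the lowered column maxima; of the minima it is only used that
  they do not decrease.\<close>

lemma spread_mult:
  assumes A: "A \<in> stochastic_mats"
  shows "spread (A ** B) \<le> (1 - min_entry A) * spread B"
proof -
  have "spread (A ** B) \<le> (\<Sum>j\<in>UNIV. (1 - min_entry A) * (col_max B j - col_min B j))"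
    unfolding spread_def
  proof (rule sum_mono)
    fix j
    show "col_max (A ** B) j - col_min (A ** B) j \<le> (1 - min_entry A) * (col_max B j - col_min B j)"
      using col_min_mult[OF A, of B j] col_max_mult[OF A, of B j] by (simp add: algebra_simps)
  qed
  then show ?thesis by (simp add: spread_def sum_distrib_left)
qed

text \<open>Factors added on the left make the column ranges a nested sequence of intervals. A
  spread that is small at one index therefore stays small, and every entry of a column is squeezed
  to the same point \<open>l j\<close>.\<close>

lemma left_prod_convergent:
  fixes A :: "nat \<Rightarrow> real^'n::finite^'n"
  assumes A: "\<And>k. 1 \<le> k \<Longrightarrow> A k \<in> stochastic_mats"
    and small: "\<And>e. 0 < e \<Longrightarrow> \<exists>n. spread (left_prod A n) < e"
  obtains L where "left_prod A \<longlonglongrightarrow> L" "\<forall>i j. row i L = row j L"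
proof -
  have max_mono: "col_max (left_prod A (Suc n)) j \<le> col_max (left_prod A n) j" for n j
  proof -
    have "0 \<le> min_entry (A (Suc n)) * (col_max (left_prod A n) j - col_min (left_prod A n) j)"
      using min_entry_nonneg[OF A, of "Suc n"] col_min_le_max[of "left_prod A n" j] by simp
    then show ?thesis using col_max_mult[OF A, of "Suc n" "left_prod A n" j] by simp
  qed
  have dec: "decseq (\<lambda>n. col_max (left_prod A n) j)" for j
    by (rule decseq_SucI) (rule max_mono)
  have inc: "incseq (\<lambda>n. col_min (left_prod A n) j)" for j
    by (rule incseq_SucI) (simp add: A col_min_mult)
  have cross: "col_min (left_prod A n) j \<le> col_max (left_prod A m) j" for n m j
    using incseqD[OF inc[of j], of n "max n m"] decseqD[OF dec[of j], of m "max n m"]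
      col_min_le_max[of "left_prod A (max n m)" j] by simp
  define l where "l j = (SUP n. col_min (left_prod A n) j)" for j
  have l: "col_min (left_prod A n) j \<le> l j" "l j \<le> col_max (left_prod A n) j" for n j
    unfolding l_def using cross by (auto intro!: cSUP_upper cSUP_least bdd_aboveI2)
  have "(\<lambda>n. left_prod A n $ i $ j) \<longlonglongrightarrow> l j" for i j
  proof (rule LIMSEQ_I)
    fix e :: real assume "0 < e"
    then obtain N where N: "spread (left_prod A N) < e" using small by blast
    have "norm (left_prod A n $ i $ j - l j) < e" if "N \<le> n" for n
    proof -
      have "\<bar>left_prod A n $ i $ j - l j\<bar> \<le> col_max (left_prod A n) j - col_min (left_prod A n) j"
        using l[where n=n and j=j] col_bounds[where B="left_prod A n" and j=j and i=i] by (simp add: abs_le_iff)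
      also have "\<dots> \<le> col_max (left_prod A N) j - col_min (left_prod A N) j"
        using incseqD[OF inc that] decseqD[OF dec that] by (intro diff_mono)
      also have "\<dots> \<le> spread (left_prod A N)"
        unfolding spread_def using col_min_le_max by (intro member_le_sum) auto
      finally show ?thesis using N by simp
    qed
    then show "\<exists>N. \<forall>n\<ge>N. norm (left_prod A n $ i $ j - l j) < e" by blast
  qed
  then have "left_prod A \<longlonglongrightarrow> (\<chi> i j. l j)"
    by (intro vec_tendstoI) simp
  then show ?thesis by (rule that) (simp add: row_def)
qed

text \<open>Almost sure convergence implies convergence in law. Fatou's lemma yields
  \<open>\<le>\<close> on open sets and outer regularity extends it to Borel sets; applied to a set
  and to its complement, it becomes an equality because both measures have mass 1.\<close>

lemma distr_limit_eq:
  fixes Z :: "nat \<Rightarrow> 'a \<Rightarrow> 'b::polish_space"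
  assumes "prob_space Q" and [measurable]: "\<And>n. Z n \<in> borel_measurable Q" "Y \<in> borel_measurable Q"
    and lim: "AE x in Q. (\<lambda>n. Z n x) \<longlonglongrightarrow> Y x"
    and law: "\<And>n. distr Q borel (Z n) = \<rho>"
  shows "distr Q borel Y = \<rho>"
proof -
  interpret Q: prob_space Q by fact
  interpret Y: prob_space "distr Q borel Y" by (rule Q.prob_space_distr) measurable
  have \<rho>: "prob_space \<rho>" using law[of 0] Q.prob_space_distr[of "Z 0" borel] by simp
  then interpret \<rho>: prob_space \<rho> .
  have sets[simp]: "sets \<rho> = sets borel" using law[of 0] by (metis sets_distr)
  have "space \<rho> = UNIV" using sets_eq_imp_space_eq[OF sets] by simp
  have open_le: "emeasure (distr Q borel Y) U \<le> emeasure \<rho> U" if "open U" for U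
  proof -
    have [measurable]: "U \<in> sets borel" using that by simp
    have "emeasure (distr Q borel Y) U = (\<integral>\<^sup>+x. indicator U (Y x) \<partial>Q)"
    proof -
      have "(\<integral>\<^sup>+x. indicator U (Y x) \<partial>Q) = (\<integral>\<^sup>+y. indicator U y \<partial>distr Q borel Y)"
        by (subst nn_integral_distr) auto
      then show ?thesis by simp
    qed
    \<comment> \<open>A limit in the open set \<open>U\<close> forces \<open>Z n x\<close> into
      \<open>U\<close> eventually; outside \<open>U\<close> the left side is 0.\<close>
    also have "\<dots> \<le> (\<integral>\<^sup>+x. liminf (\<lambda>n. indicator U (Z n x)) \<partial>Q)"
    proof (rule nn_integral_mono_AE)
      show "AE x in Q. indicator U (Y x) \<le> liminf (\<lambda>n. indicator U (Z n x) :: ennreal)"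
        using lim
      proof eventually_elim
        case (elim x)
        show ?case
        proof (cases "Y x \<in> U")
          case True
          then have "\<forall>\<^sub>F n in sequentially. Z n x \<in> U" using elim that topological_tendstoD by blast
          then have "\<forall>\<^sub>F n in sequentially. (1::ennreal) \<le> indicator U (Z n x)"
            by eventually_elim simp
          then have "1 \<le> liminf (\<lambda>n. indicator U (Z n x) :: ennreal)" by (rule Liminf_bounded)
          then show ?thesis using True by simp
        qed simp
      qed
    qed
    also have "\<dots> \<le> liminf (\<lambda>n. \<integral>\<^sup>+x. indicator U (Z n x) \<partial>Q)"
      by (rule nn_integral_liminf) measurable
    also have "(\<lambda>n. \<integral>\<^sup>+x. indicator U (Z n x) \<partial>Q) = (\<lambda>n. emeasure \<rho> U)"
    proof
      fix n
      have "(\<integral>\<^sup>+x. indicator U (Z n x) \<partial>Q) = (\<integral>\<^sup>+y. indicator U y \<partial>distr Q borel (Z n))"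
        by (subst nn_integral_distr) auto
      then show "(\<integral>\<^sup>+x. indicator U (Z n x) \<partial>Q) = emeasure \<rho> U" by (simp add: law)
    qed
    finally show ?thesis by (simp add: Liminf_const)
  qed
  have le: "emeasure (distr Q borel Y) B \<le> emeasure \<rho> B" if "B \<in> sets borel" for B
    using that Y.emeasure_finite \<rho>.emeasure_finite
    by (subst (1 2) outer_regular) (auto intro!: INF_mono' open_le INF_mono)
  show ?thesis
  proof (rule measure_eqI)
    fix B assume "B \<in> sets (distr Q borel Y)"
    then have B: "B \<in> sets borel" by simp
    have "measure (distr Q borel Y) B \<le> measure \<rho> B" "measure (distr Q borel Y) (- B) \<le> measure \<rho> (- B)"
      using le[OF B] le[of "- B"] B
      by (auto simp: Y.emeasure_eq_measure \<rho>.emeasure_eq_measure borel_comp)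
    moreover have "measure (distr Q borel Y) (- B) = 1 - measure (distr Q borel Y) B"
      using Y.prob_compl[of B] B by (simp add: Compl_eq_Diff_UNIV)
    moreover have "measure \<rho> (- B) = 1 - measure \<rho> B"
      using \<rho>.prob_compl[of B] B \<open>space \<rho> = UNIV\<close> by (simp add: Compl_eq_Diff_UNIV)
    ultimately show "emeasure (distr Q borel Y) B = emeasure \<rho> B"
      by (simp add: Y.emeasure_eq_measure \<rho>.emeasure_eq_measure)
  qed simp
qed

text \<open>For a fixed radius \<open>s\<close>, linearity gives
  \<open>(s *\<^sub>R x) v* A = s *\<^sub>R (x v* A)\<close>, so invariance of the direction passes
  to each scaled copy. The radius is independent of both direction and matrix and is integrated out
  last.\<close>

lemma gamma_vec_law_invariantI:
  fixes \<mu> :: "(real^'n::{finite,linorder}^'n::{finite,linorder}) measure"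
  assumes a: "a \<in> pos_vecs" and \<mu>: "prob_space \<mu>" and sets[measurable_cong]: "sets \<mu> = sets borel"
    and inv: "distr (dirichlet_law a \<Otimes>\<^sub>M \<mu>) borel (\<lambda>(x, A). x v* A) = dirichlet_law a"
  shows "distr (gamma_vec_law a \<Otimes>\<^sub>M \<mu>) borel (\<lambda>(x, A). x v* A) = gamma_vec_law a"
proof (rule measure_eqI_nn_integral)
  interpret \<mu>: prob_space \<mu> by fact
  fix f :: "_ \<Rightarrow> ennreal"
  assume "f \<in> borel_measurable (distr (gamma_vec_law a \<Otimes>\<^sub>M \<mu>) borel (\<lambda>(x, A). x v* A))"
  then have [measurable]: "f \<in> borel_measurable borel" by simp
  have "(\<integral>\<^sup>+v. f v \<partial>distr (gamma_vec_law a \<Otimes>\<^sub>M \<mu>) borel (\<lambda>(x, A). x v* A))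
      = (\<integral>\<^sup>+v. (\<integral>\<^sup>+A. f (v v* A) \<partial>\<mu>) \<partial>gamma_vec_law a)"
    by (simp add: nn_integral_distr \<mu>.nn_integral_fst[symmetric] case_prod_unfold)
  also have "\<dots> = (\<integral>\<^sup>+s. (\<integral>\<^sup>+x. (\<integral>\<^sup>+A. f ((s *\<^sub>R x) v* A) \<partial>\<mu>) \<partial>dirichlet_law a) \<partial>gamma_law (\<Sum>i\<in>UNIV. a $ i))"
    by (rule nn_integral_gamma_vec_law[OF a]) measurable
  also have "\<dots> = (\<integral>\<^sup>+s. (\<integral>\<^sup>+x. f (s *\<^sub>R x) \<partial>dirichlet_law a) \<partial>gamma_law (\<Sum>i\<in>UNIV. a $ i))"
  proof (rule nn_integral_cong)
    fix s
    have "(\<integral>\<^sup>+x. f (s *\<^sub>R x) \<partial>dirichlet_law a)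
        = (\<integral>\<^sup>+x. f (s *\<^sub>R x) \<partial>distr (dirichlet_law a \<Otimes>\<^sub>M \<mu>) borel (\<lambda>(x, A). x v* A))"
      by (simp only: inv)
    also have "\<dots> = (\<integral>\<^sup>+x. (\<integral>\<^sup>+A. f (s *\<^sub>R (x v* A)) \<partial>\<mu>) \<partial>dirichlet_law a)"
      by (simp add: nn_integral_distr \<mu>.nn_integral_fst[symmetric] case_prod_unfold)
    finally show "(\<integral>\<^sup>+x. (\<integral>\<^sup>+A. f ((s *\<^sub>R x) v* A) \<partial>\<mu>) \<partial>dirichlet_law a)
        = (\<integral>\<^sup>+x. f (s *\<^sub>R x) \<partial>dirichlet_law a)"
      by (simp add: scaleR_vector_matrix_assoc)
  qed
  also have "\<dots> = (\<integral>\<^sup>+v. f v \<partial>gamma_vec_law a)"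
    by (rule nn_integral_gamma_vec_law[OF a, symmetric]) measurable
  finally show "(\<integral>\<^sup>+v. f v \<partial>distr (gamma_vec_law a \<Otimes>\<^sub>M \<mu>) borel (\<lambda>(x, A). x v* A))
    = (\<integral>\<^sup>+v. f v \<partial>gamma_vec_law a)" .
qed simp

section \<open>Products of independent random matrices\<close>

declare One_nat_def [simp del] \<comment> \<open>keeps the index set \<open>{1..}\<close> in normal form\<close>

section \<open>Inserting a first factor into an i.i.d. sequence\<close>

lemma left_prod_cong:
  assumes "\<And>k. 1 \<le> k \<Longrightarrow> A k = B k"
  shows "left_prod A n = left_prod B n"
  by (induction n) (simp_all add: assms)

text \<open>The restriction to \<open>{1..}\<close> keeps the result among the points of the product
  space, whose values are \<open>undefined\<close> off the index set.\<close>

definition prepend :: "'a \<Rightarrow> (nat \<Rightarrow> 'a) \<Rightarrow> nat \<Rightarrow> 'a" where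
  "prepend A \<omega> = (\<lambda>i\<in>{1..}. if i = 1 then A else \<omega> (i - 1))"

text \<open>The factor of index 1 stands rightmost, so insertion at the start acts on the right
  while the recursion acts on the left; associativity reconciles them.\<close>

lemma left_prod_prepend: "left_prod (prepend A \<omega>) (Suc n) = left_prod \<omega> n ** A"
proof (induction n)
  case 0
  then show ?case by (simp add: prepend_def)
next
  case (Suc n)
  have "left_prod (prepend A \<omega>) (Suc (Suc n)) = prepend A \<omega> (Suc (Suc n)) ** left_prod (prepend A \<omega>) (Suc n)"
    by simp
  also have "\<dots> = \<omega> (Suc n) ** (left_prod \<omega> n ** A)"
    unfolding Suc.IH by (simp add: prepend_def)
  finally show ?case by (simp add: matrix_mul_assoc)
qed

locale random_stochastic = prob_space \<mu>
  for \<mu> :: "(real^'n::finite^'n) measure" +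
  assumes sets_law[measurable_cong, simp]: "sets \<mu> = sets borel"
    and AE_stochastic: "AE A in \<mu>. A \<in> stochastic_mats"
begin

abbreviation "seq_law \<equiv> Pi\<^sub>M {1::nat..} (\<lambda>_. \<mu>)"

sublocale seq: prob_space seq_law
  by (intro prob_space_PiM) unfold_locales

sublocale seq_pair: pair_prob_space \<mu> seq_law ..

lemma prepend_measurable[measurable]: "(\<lambda>(A, \<omega>). prepend A \<omega>) \<in> \<mu> \<Otimes>\<^sub>M seq_law \<rightarrow>\<^sub>M seq_law"
  unfolding prepend_def case_prod_unfold
proof (rule measurable_restrict)
  fix i :: nat assume "i \<in> {1..}"
  then show "(\<lambda>p. if i = 1 then fst p else snd p (i - 1)) \<in> \<mu> \<Otimes>\<^sub>M seq_law \<rightarrow>\<^sub>M \<mu>"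
    by (cases "i = 1") auto
qed

text \<open>For sequences indexed from 0 this is \<open>S.PiM_iter\<close> with
  \<open>case_nat\<close>. The map \<open>r\<close> moves the indices up by one and turns
  \<open>case_nat\<close> into \<open>prepend\<close>.\<close>

lemma distr_prepend: "distr (\<mu> \<Otimes>\<^sub>M seq_law) seq_law (\<lambda>(A, \<omega>). prepend A \<omega>) = seq_law"
proof -
  interpret S: sequence_space \<mu> ..
  define r where "r \<omega> = (\<lambda>n\<in>{1::nat..}. \<omega> (n - 1))" for \<omega> :: "nat \<Rightarrow> real^'n^'n"
  have r: "distr S.S seq_law r = seq_law"
    using distr_PiM_reindex[of UNIV "\<lambda>_. \<mu>" "\<lambda>n::nat. n - 1" "{1..}"] prob_space_axioms
    by (auto simp: r_def[abs_def] inj_on_def eq_diff_iff)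
  have r_meas[measurable]: "r \<in> S.S \<rightarrow>\<^sub>M seq_law"
    unfolding r_def by measurable
  have case_meas[measurable]: "(\<lambda>(A, \<omega>). case_nat A \<omega>) \<in> \<mu> \<Otimes>\<^sub>M S.S \<rightarrow>\<^sub>M S.S"
    by measurable
  have eq: "prepend A (r \<omega>) = r (case_nat A \<omega>)" for A \<omega>
    by (rule ext) (auto simp: prepend_def r_def split: nat.split intro!: arg_cong[of _ _ \<omega>])
  have "\<mu> \<Otimes>\<^sub>M seq_law = distr \<mu> \<mu> (\<lambda>x. x) \<Otimes>\<^sub>M distr S.S seq_law r"
    by (simp add: r)
  also have "\<dots> = distr (\<mu> \<Otimes>\<^sub>M S.S) (\<mu> \<Otimes>\<^sub>M seq_law) (\<lambda>(A, \<omega>). (A, r \<omega>))"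
    by (rule pair_measure_distr) (auto simp: r seq.sigma_finite_measure_axioms)
  finally have "distr (\<mu> \<Otimes>\<^sub>M seq_law) seq_law (\<lambda>(A, \<omega>). prepend A \<omega>)
      = distr (distr (\<mu> \<Otimes>\<^sub>M S.S) (\<mu> \<Otimes>\<^sub>M seq_law) (\<lambda>(A, \<omega>). (A, r \<omega>))) seq_law (\<lambda>(A, \<omega>). prepend A \<omega>)"
    by simp
  also have "\<dots> = distr (\<mu> \<Otimes>\<^sub>M S.S) seq_law ((\<lambda>(A, \<omega>). prepend A \<omega>) \<circ> (\<lambda>(A, \<omega>). (A, r \<omega>)))"
    by (rule distr_distr) measurable
  also have "((\<lambda>(A, \<omega>). prepend A \<omega>) \<circ> (\<lambda>(A, \<omega>). (A, r \<omega>))) = r \<circ> (\<lambda>(A, \<omega>). case_nat A \<omega>)"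
    by (auto simp: eq)
  also have "distr (\<mu> \<Otimes>\<^sub>M S.S) seq_law \<dots> = distr (distr (\<mu> \<Otimes>\<^sub>M S.S) S.S (\<lambda>(A, \<omega>). case_nat A \<omega>)) seq_law r"
    by (rule distr_distr[symmetric]) measurable
  also have "\<dots> = seq_law" by (simp add: S.PiM_iter r)
  finally show ?thesis .
qed

lemma left_prod_measurable[measurable]: "(\<lambda>\<omega>. left_prod \<omega> n) \<in> seq_law \<rightarrow>\<^sub>M borel"
proof (induction n)
  case (Suc n)
  have [measurable]: "(\<lambda>\<omega>. \<omega> (Suc n)) \<in> seq_law \<rightarrow>\<^sub>M borel"
    using measurable_component_singleton[of "Suc n" "{1..}" "\<lambda>_. \<mu>"]
    by (simp add: measurable_cong_sets[OF refl sets_law])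
  show ?case using Suc by simp
qed simp

lemma AE_seq_stochastic: "AE \<omega> in seq_law. \<forall>k\<ge>1. \<omega> k \<in> stochastic_mats"
  unfolding AE_all_countable
proof
  fix k :: nat
  show "AE \<omega> in seq_law. 1 \<le> k \<longrightarrow> \<omega> k \<in> stochastic_mats"
  proof (cases "1 \<le> k")
    case True
    have "AE \<omega> in seq_law. \<omega> k \<in> stochastic_mats"
      by (rule AE_PiM_component) (use True AE_stochastic prob_space_axioms in auto)
    then show ?thesis by simp
  qed simp
qed

lemma AE_left_prod_stochastic: "AE \<omega> in seq_law. \<forall>n. left_prod \<omega> n \<in> stochastic_mats"
  using AE_seq_stochastic by eventually_elim (auto intro: left_prod_stochastic)

lemma nn_integral_prepend:
  assumes [measurable]: "f \<in> borel_measurable seq_law"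
  shows "(\<integral>\<^sup>+\<omega>. f \<omega> \<partial>seq_law) = (\<integral>\<^sup>+A. (\<integral>\<^sup>+\<omega>. f (prepend A \<omega>) \<partial>seq_law) \<partial>\<mu>)"
proof -
  have "(\<integral>\<^sup>+\<omega>. f \<omega> \<partial>seq_law)
      = (\<integral>\<^sup>+\<omega>. f \<omega> \<partial>distr (\<mu> \<Otimes>\<^sub>M seq_law) seq_law (\<lambda>(A, \<omega>). prepend A \<omega>))"
    by (simp only: distr_prepend)
  also have "\<dots> = (\<integral>\<^sup>+p. f (prepend (fst p) (snd p)) \<partial>(\<mu> \<Otimes>\<^sub>M seq_law))"
    using prepend_measurable assms by (subst nn_integral_distr) (auto simp: case_prod_unfold)
  also have "\<dots> = (\<integral>\<^sup>+A. (\<integral>\<^sup>+\<omega>. f (prepend A \<omega>) \<partial>seq_law) \<partial>\<mu>)"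
    using measurable_compose[OF prepend_measurable assms]
    by (subst seq.nn_integral_fst[symmetric]) (auto simp: case_prod_unfold)
  finally show ?thesis .
qed

section \<open>Expected oscillation and almost sure convergence\<close>

lemma nn_integral_left_prod_Suc:
  assumes [measurable]: "f \<in> borel_measurable borel"
  shows "(\<integral>\<^sup>+\<omega>. f (left_prod \<omega> (Suc n)) \<partial>seq_law)
    = (\<integral>\<^sup>+A. (\<integral>\<^sup>+\<omega>. f (left_prod \<omega> n ** A) \<partial>seq_law) \<partial>\<mu>)"
proof -
  have "(\<lambda>\<omega>. f (left_prod \<omega> (Suc n))) \<in> borel_measurable seq_law"
    using left_prod_measurable by (rule measurable_compose) fact
  from nn_integral_prepend[OF this] show ?thesis by (simp only: left_prod_prepend)
qed

text \<open>The earliest \<open>m\<close> factors, standing on the right, are independent of the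
  \<open>n\<close> later ones, and by identical distribution both blocks can be modelled by
  sequences that start at index 1.\<close>

lemma nn_integral_left_prod_add:
  assumes [measurable]: "f \<in> borel_measurable borel"
  shows "(\<integral>\<^sup>+\<omega>. f (left_prod \<omega> (n + m)) \<partial>seq_law)
    = (\<integral>\<^sup>+\<omega>'. (\<integral>\<^sup>+\<omega>. f (left_prod \<omega> n ** left_prod \<omega>' m) \<partial>seq_law) \<partial>seq_law)"
  using assms
proof (induction m arbitrary: f)
  case 0
  then show ?case by (simp add: seq.emeasure_space_1)
next
  case (Suc m)
  note Suc.prems[measurable]
  have "(\<integral>\<^sup>+\<omega>. f (left_prod \<omega> (n + Suc m)) \<partial>seq_law)
      = (\<integral>\<^sup>+A. (\<integral>\<^sup>+\<omega>. f (left_prod \<omega> (n + m) ** A) \<partial>seq_law) \<partial>\<mu>)"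
    using nn_integral_left_prod_Suc[OF Suc.prems, of "n + m"] by simp
  \<comment> \<open>For each fixed \<open>A\<close> the induction hypothesis is applied to
    \<open>B \<mapsto> f (B ** A)\<close>, hence the generalization over \<open>f\<close>.\<close>
  also have "\<dots> = (\<integral>\<^sup>+A. (\<integral>\<^sup>+\<omega>'. (\<integral>\<^sup>+\<omega>. f (left_prod \<omega> n ** (left_prod \<omega>' m ** A)) \<partial>seq_law) \<partial>seq_law) \<partial>\<mu>)"
    by (rule nn_integral_cong) (subst Suc.IH, measurable, simp add: matrix_mul_assoc)
  also have "\<dots> = (\<integral>\<^sup>+\<omega>'. (\<integral>\<^sup>+\<omega>. f (left_prod \<omega> n ** left_prod \<omega>' (Suc m)) \<partial>seq_law) \<partial>seq_law)"
    by (rule nn_integral_left_prod_Suc[symmetric]) measurable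
  finally show ?case .
qed

text \<open>The product of \<open>k * m\<close> factors consists of \<open>k\<close> independent
  blocks. The leftmost block contracts the spread of the rest by a random factor with mean
  \<open>c\<close>, and independence lets the means multiply.\<close>

lemma nn_integral_spread_left_prod:
  fixes m :: nat
  defines "c \<equiv> \<integral>\<^sup>+\<omega>. ennreal (1 - min_entry (left_prod \<omega> m)) \<partial>seq_law"
  shows "(\<integral>\<^sup>+\<omega>. ennreal (spread (left_prod \<omega> (k * m))) \<partial>seq_law)
    \<le> c ^ k * ennreal (spread (mat 1 :: real^'n^'n))"
proof (induction k)
  case 0
  then show ?case by (simp add: seq.emeasure_space_1)
next
  case (Suc k)
  have "(\<integral>\<^sup>+\<omega>. ennreal (spread (left_prod \<omega> (Suc k * m))) \<partial>seq_law)
      = (\<integral>\<^sup>+\<omega>'. (\<integral>\<^sup>+\<omega>. ennreal (spread (left_prod \<omega> m ** left_prod \<omega>' (k * m))) \<partial>seq_law) \<partial>seq_law)"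
    using nn_integral_left_prod_add[of "\<lambda>A. ennreal (spread A)" m "k * m"] by simp
  also have "\<dots> \<le> (\<integral>\<^sup>+\<omega>'. (\<integral>\<^sup>+\<omega>. ennreal (1 - min_entry (left_prod \<omega> m)) *
      ennreal (spread (left_prod \<omega>' (k * m))) \<partial>seq_law) \<partial>seq_law)"
  proof (rule nn_integral_mono, rule nn_integral_mono_AE)
    fix \<omega>'
    show "AE \<omega> in seq_law. ennreal (spread (left_prod \<omega> m ** left_prod \<omega>' (k * m)))
        \<le> ennreal (1 - min_entry (left_prod \<omega> m)) * ennreal (spread (left_prod \<omega>' (k * m)))"
      using AE_left_prod_stochastic
    proof eventually_elim
      case (elim \<omega>)
      then show ?case
        using spread_mult[of "left_prod \<omega> m" "left_prod \<omega>' (k * m)"] min_entry_le_1[of "left_prod \<omega> m"]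
        by (simp add: ennreal_mult'[symmetric] ennreal_leI)
    qed
  qed
  also have "\<dots> = c * (\<integral>\<^sup>+\<omega>'. ennreal (spread (left_prod \<omega>' (k * m))) \<partial>seq_law)"
    unfolding c_def by (simp add: nn_integral_multc nn_integral_cmult)
  also have "\<dots> \<le> c * (c ^ k * ennreal (spread (mat 1 :: real^'n^'n)))"
    by (intro mult_left_mono Suc) simp
  finally show ?case by (simp add: mult.assoc)
qed

text \<open>A positive block with positive probability makes the mean contraction factor
  \<open>c\<close> strictly less than 1, so the expected spread decays geometrically along the
  multiples of \<open>m\<close>.\<close>

lemma AE_left_prod_convergent:
  assumes pos: "0 < measure seq_law {\<omega> \<in> space seq_law. left_prod \<omega> m \<in> pos_stochastic_mats}"
  shows "AE \<omega> in seq_law. \<exists>L. left_prod \<omega> \<longlonglongrightarrow> L \<and> (\<forall>i j. row i L = row j L)"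
proof -
  define c where "c = (\<integral>\<^sup>+\<omega>. ennreal (1 - min_entry (left_prod \<omega> m)) \<partial>seq_law)"
  define p where "p = (\<integral>\<^sup>+\<omega>. ennreal (min_entry (left_prod \<omega> m)) \<partial>seq_law)"
  \<comment> \<open>Keeping \<open>c + p = 1\<close> avoids subtraction in \<open>ennreal\<close>;
    the bound \<open>c < 1\<close> is later drawn from \<open>p \<noteq> 0\<close>.\<close>
  have "c + p = (\<integral>\<^sup>+\<omega>. ennreal (1 - min_entry (left_prod \<omega> m)) + ennreal (min_entry (left_prod \<omega> m)) \<partial>seq_law)"
    unfolding c_def p_def by (rule nn_integral_add[symmetric]) measurable
  also have "\<dots> = (\<integral>\<^sup>+\<omega>. 1 \<partial>seq_law)"
  proof (rule nn_integral_cong_AE)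
    show "AE \<omega> in seq_law. ennreal (1 - min_entry (left_prod \<omega> m)) + ennreal (min_entry (left_prod \<omega> m)) = 1"
      using AE_left_prod_stochastic
      by eventually_elim (simp add: ennreal_plus[symmetric] min_entry_nonneg min_entry_le_1 del: ennreal_plus)
  qed
  finally have cp: "c + p = 1" by (simp add: seq.emeasure_space_1)
  have "p \<noteq> 0"
  proof
    assume "p = 0"
    then have "AE \<omega> in seq_law. ennreal (min_entry (left_prod \<omega> m)) = 0"
      unfolding p_def by (subst (asm) nn_integral_0_iff_AE) measurable
    then have "AE \<omega> in seq_law. left_prod \<omega> m \<notin> pos_stochastic_mats"
    proof eventually_elim
      case (elim \<omega>)
      then have "\<not> 0 < min_entry (left_prod \<omega> m)" by (simp add: ennreal_eq_0_iff)
      then show ?case unfolding min_entry_pos by (auto simp: pos_stochastic_mats_def)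
    qed
    then have "measure seq_law {\<omega> \<in> space seq_law. left_prod \<omega> m \<in> pos_stochastic_mats} = 0"
      by (subst seq.prob_eq_0) auto
    then show False using pos by simp
  qed
  obtain r where r: "c = ennreal r" "0 \<le> r" "r < 1"
  proof (cases c)
    case (real r)
    have "r < 1"
    proof (rule ccontr)
      assume "\<not> r < 1"
      then have "1 \<le> c" using real by simp
      then have "1 + p \<le> 1 + 0" using cp by (metis add.right_neutral add_right_mono)
      then have "p = 0" by (subst (asm) ennreal_add_left_cancel_le) auto
      then show False using \<open>p \<noteq> 0\<close> by simp
    qed
    then show ?thesis using that real by blast
  next
    case top
    then show ?thesis using cp by simp
  qed
  define s where "s = spread (mat 1 :: real^'n^'n)"
  \<comment> \<open>The infimum lies below every term, so its integral is 0 before anything is known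
    about convergence of the spreads; arbitrarily small spreads are all that
    \<open>left_prod_convergent\<close> asks for.\<close>
  define I where "I \<omega> = (INF k. ennreal (spread (left_prod \<omega> (k * m))))" for \<omega> :: "nat \<Rightarrow> real^'n^'n"
  have [measurable]: "I \<in> borel_measurable seq_law" unfolding I_def by measurable
  have "(\<integral>\<^sup>+\<omega>. I \<omega> \<partial>seq_law) \<le> ennreal (r ^ k * s)" for k
  proof -
    have "(\<integral>\<^sup>+\<omega>. I \<omega> \<partial>seq_law) \<le> (\<integral>\<^sup>+\<omega>. ennreal (spread (left_prod \<omega> (k * m))) \<partial>seq_law)"
      unfolding I_def by (intro nn_integral_mono INF_lower) simp
    also have "\<dots> \<le> c ^ k * ennreal s"
      unfolding c_def s_def by (rule nn_integral_spread_left_prod)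
    also have "\<dots> = ennreal (r ^ k * s)"
      using r by (simp add: ennreal_power ennreal_mult s_def spread_nonneg)
    finally show ?thesis .
  qed
  moreover have "(\<lambda>k. ennreal (r ^ k * s)) \<longlonglongrightarrow> ennreal (0 * s)"
    using r by (intro tendsto_ennrealI tendsto_mult LIMSEQ_realpow_zero tendsto_const) auto
  ultimately have "(\<integral>\<^sup>+\<omega>. I \<omega> \<partial>seq_law) \<le> ennreal (0 * s)"
    by (intro LIMSEQ_le_const) auto
  then have "AE \<omega> in seq_law. I \<omega> = 0" by (subst nn_integral_0_iff_AE[symmetric]) auto
  with AE_seq_stochastic show ?thesis
  proof eventually_elim
    case (elim \<omega>)
    have "\<exists>n. spread (left_prod \<omega> n) < e" if "0 < e" for e
    proof -
      have "(INF k. ennreal (spread (left_prod \<omega> (k * m)))) < ennreal e"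
        using elim(2) that by (simp add: I_def)
      then obtain k where "ennreal (spread (left_prod \<omega> (k * m))) < ennreal e"
        by (auto simp: INF_less_iff)
      then show ?thesis using that by (auto simp: ennreal_less_iff spread_nonneg)
    qed
    then show ?case using left_prod_convergent[of \<omega>] elim(1) by metis
  qed
qed

text \<open>Fubini places the rightmost factor \<open>A\<close> outermost. The induction hypothesis
  for \<open>v \<mapsto> f (v v* A)\<close> removes the other factors, and invariance of
  \<open>\<rho>\<close> then removes \<open>A\<close>.\<close>

lemma nn_integral_invariant_left_prod:
  fixes \<rho> :: "(real^'n) measure"
  assumes "prob_space \<rho>" and [measurable_cong]: "sets \<rho> = sets borel"
    and inv: "distr (\<rho> \<Otimes>\<^sub>M \<mu>) borel (\<lambda>(v, A). v v* A) = \<rho>"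
    and "f \<in> borel_measurable borel"
  shows "(\<integral>\<^sup>+v. (\<integral>\<^sup>+\<omega>. f (v v* left_prod \<omega> n) \<partial>seq_law) \<partial>\<rho>) = (\<integral>\<^sup>+v. f v \<partial>\<rho>)"
  using \<open>f \<in> borel_measurable borel\<close>
proof (induction n arbitrary: f)
  case 0
  then show ?case by (simp add: seq.emeasure_space_1)
next
  case (Suc n)
  note Suc.prems[measurable]
  interpret \<rho>: prob_space \<rho> by fact
  interpret Q: pair_sigma_finite \<rho> \<mu> ..
  have "(\<integral>\<^sup>+v. (\<integral>\<^sup>+\<omega>. f (v v* left_prod \<omega> (Suc n)) \<partial>seq_law) \<partial>\<rho>)
      = (\<integral>\<^sup>+v. (\<integral>\<^sup>+A. (\<integral>\<^sup>+\<omega>. f ((v v* left_prod \<omega> n) v* A) \<partial>seq_law) \<partial>\<mu>) \<partial>\<rho>)"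
    by (rule nn_integral_cong) (subst nn_integral_left_prod_Suc, measurable, simp add: vector_matrix_mul_assoc)
  also have "\<dots> = (\<integral>\<^sup>+A. (\<integral>\<^sup>+v. (\<integral>\<^sup>+\<omega>. f ((v v* left_prod \<omega> n) v* A) \<partial>seq_law) \<partial>\<rho>) \<partial>\<mu>)"
    by (rule Q.Fubini'[symmetric]) measurable
  also have "\<dots> = (\<integral>\<^sup>+A. (\<integral>\<^sup>+v. f (v v* A) \<partial>\<rho>) \<partial>\<mu>)"
    by (rule nn_integral_cong) (rule Suc.IH, measurable)
  also have "\<dots> = (\<integral>\<^sup>+v. (\<integral>\<^sup>+A. f (v v* A) \<partial>\<mu>) \<partial>\<rho>)"
    by (rule Q.Fubini') measurable
  also have "\<dots> = (\<integral>\<^sup>+v. f v \<partial>distr (\<rho> \<Otimes>\<^sub>M \<mu>) borel (\<lambda>(v, A). v v* A))"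
  proof -
    have m: "(\<lambda>p. f (fst p v* snd p)) \<in> borel_measurable (\<rho> \<Otimes>\<^sub>M \<mu>)" by measurable
    show ?thesis using nn_integral_fst[OF m] by (simp add: nn_integral_distr case_prod_unfold)
  qed
  finally show ?case by (simp only: inv)
qed

section \<open>The almost sure limit and the laws of its rows\<close>

lemma canonical_limit:
  assumes "as_limit seq_law (\<lambda>n \<omega>. \<omega> n) L"
  shows "L \<in> borel_measurable seq_law" "AE \<omega> in seq_law. left_prod \<omega> \<longlonglongrightarrow> L \<omega>"
  using assms by (simp_all add: as_limit_def)

lemma AE_limit_stochastic:
  assumes L: "as_limit seq_law (\<lambda>n \<omega>. \<omega> n) L"
  shows "AE \<omega> in seq_law. L \<omega> \<in> stochastic_mats"
  using canonical_limit(2)[OF L] AE_left_prod_stochastic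
  by eventually_elim (auto intro: closed_sequentially[OF closed_stochastic_mats])

text \<open>An invariant law \<open>\<rho>\<close> is transported unchanged by every left product, hence by the limit \<open>L\<close>,
  which maps \<open>v\<close> to the multiple of its common row with the coordinate sum of \<open>v\<close>.\<close>
lemma limit_row_law:
  fixes \<rho> :: "(real^'n) measure"
  assumes L: "as_limit seq_law (\<lambda>n \<omega>. \<omega> n) L"
    and rows: "AE \<omega> in seq_law. \<forall>i j. row i (L \<omega>) = row j (L \<omega>)"
    and "prob_space \<rho>" and sets[measurable_cong, simp]: "sets \<rho> = sets borel"
    and inv: "distr (\<rho> \<Otimes>\<^sub>M \<mu>) borel (\<lambda>(v, A). v v* A) = \<rho>"
    and pos: "AE v in \<rho>. 0 < (\<Sum>i\<in>UNIV. v $ i)"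
  shows "distr seq_law borel (\<lambda>\<omega>. row i (L \<omega>)) = distr \<rho> borel normalized"
proof -
  interpret \<rho>: prob_space \<rho> by fact
  interpret Q: pair_prob_space \<rho> seq_law ..
  note canonical_limit(1)[OF L, measurable]
  have fst_law: "distr (\<rho> \<Otimes>\<^sub>M seq_law) \<rho> fst = \<rho>" by (rule seq.distr_pair_fst)
  have snd_law: "distr (\<rho> \<Otimes>\<^sub>M seq_law) seq_law snd = seq_law"
    by (rule distr_pair_snd) unfold_locales
  have fst_AE: "AE p in \<rho> \<Otimes>\<^sub>M seq_law. R (fst p)" if "AE v in \<rho>. R v" for R
    by (rule AE_distrD[OF measurable_fst]) (simp only: fst_law that)
  have snd_AE: "AE p in \<rho> \<Otimes>\<^sub>M seq_law. R (snd p)" if "AE \<omega> in seq_law. R \<omega>" for R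
    by (rule AE_distrD[OF measurable_snd]) (simp only: snd_law that)
  have "distr (\<rho> \<Otimes>\<^sub>M seq_law) borel (\<lambda>p. fst p v* L (snd p)) = \<rho>"
  proof (rule distr_limit_eq)
    show "prob_space (\<rho> \<Otimes>\<^sub>M seq_law)" by (intro prob_space_pair) unfold_locales
    show "(\<lambda>p. fst p v* left_prod (snd p) n) \<in> borel_measurable (\<rho> \<Otimes>\<^sub>M seq_law)" for n by measurable
    show "(\<lambda>p. fst p v* L (snd p)) \<in> borel_measurable (\<rho> \<Otimes>\<^sub>M seq_law)" by measurable
    show "AE p in \<rho> \<Otimes>\<^sub>M seq_law. (\<lambda>n. fst p v* left_prod (snd p) n) \<longlonglongrightarrow> fst p v* L (snd p)"
      using snd_AE[OF canonical_limit(2)[OF L]]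
      by eventually_elim
         (auto simp: vector_matrix_mult_def intro!: tendsto_vec_lambda tendsto_sum tendsto_mult tendsto_vec_nth)
    show "distr (\<rho> \<Otimes>\<^sub>M seq_law) borel (\<lambda>p. fst p v* left_prod (snd p) n) = \<rho>" for n
    proof (rule measure_eqI_nn_integral)
      fix f :: "_ \<Rightarrow> ennreal"
      assume "f \<in> borel_measurable (distr (\<rho> \<Otimes>\<^sub>M seq_law) borel (\<lambda>p. fst p v* left_prod (snd p) n))"
      then have f[measurable]: "f \<in> borel_measurable borel" by simp
      have m: "(\<lambda>p. f (fst p v* left_prod (snd p) n)) \<in> borel_measurable (\<rho> \<Otimes>\<^sub>M seq_law)" by measurable
      show "(\<integral>\<^sup>+v. f v \<partial>distr (\<rho> \<Otimes>\<^sub>M seq_law) borel (\<lambda>p. fst p v* left_prod (snd p) n)) = (\<integral>\<^sup>+v. f v \<partial>\<rho>)"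
        using seq.nn_integral_fst[OF m] nn_integral_invariant_left_prod[OF \<rho>.prob_space_axioms sets inv f, of n]
        by (simp add: nn_integral_distr)
    qed simp
  qed
  then have "distr \<rho> borel normalized
      = distr (distr (\<rho> \<Otimes>\<^sub>M seq_law) borel (\<lambda>p. fst p v* L (snd p))) borel normalized" by simp
  also have "\<dots> = distr (\<rho> \<Otimes>\<^sub>M seq_law) borel (\<lambda>p. normalized (fst p v* L (snd p)))"
    by (subst distr_distr) (auto simp: comp_def)
  also have "\<dots> = distr (\<rho> \<Otimes>\<^sub>M seq_law) borel (\<lambda>p. row i (L (snd p)))"
  proof (rule distr_cong_AE)
    show "AE p in \<rho> \<Otimes>\<^sub>M seq_law. normalized (fst p v* L (snd p)) = row i (L (snd p))"
      using fst_AE[OF pos] snd_AE[OF rows] snd_AE[OF AE_limit_stochastic[OF L]]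
    proof eventually_elim
      case (elim p)
      have "(\<Sum>j\<in>UNIV. row i (L (snd p)) $ j) = 1" using elim(3) by (simp add: row_def stochastic_mats_def)
      then show ?case using elim(1)
        unfolding vector_matrix_mult_equal_rows[OF elim(2), of _ i]
        by (simp add: normalized_def sum_distrib_left[symmetric])
    qed
  qed auto
  also have "\<dots> = distr (distr (\<rho> \<Otimes>\<^sub>M seq_law) seq_law snd) borel (\<lambda>\<omega>. row i (L \<omega>))"
    by (subst distr_distr) (auto simp: comp_def)
  also have "\<dots> = distr seq_law borel (\<lambda>\<omega>. row i (L \<omega>))"
    by (simp only: snd_law)
  finally show ?thesis ..
qed

text \<open>Inserting an independent first factor \<open>A\<close> turns the limit
  \<open>L \<omega>\<close> into \<open>L \<omega> ** A\<close>, since both are limits of the same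
  products, while the law of the sequence, and with it the law of the limit, stays the same.\<close>

lemma limit_row_invariant:
  fixes i :: 'n
  assumes L: "as_limit seq_law (\<lambda>n \<omega>. \<omega> n) L"
  defines "\<rho> \<equiv> distr seq_law borel (\<lambda>\<omega>. row i (L \<omega>))"
  shows "distr (\<rho> \<Otimes>\<^sub>M \<mu>) borel (\<lambda>(v, A). v v* A) = \<rho>"
proof (rule measure_eqI_nn_integral)
  note canonical_limit(1)[OF L, measurable]
  have sets[measurable_cong, simp]: "sets \<rho> = sets borel" by (simp add: \<rho>_def)
  fix f :: "_ \<Rightarrow> ennreal"
  assume "f \<in> borel_measurable (distr (\<rho> \<Otimes>\<^sub>M \<mu>) borel (\<lambda>(v, A). v v* A))"
  then have f[measurable]: "f \<in> borel_measurable borel" by simp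
  have m: "(\<lambda>p. f (fst p v* snd p)) \<in> borel_measurable (\<rho> \<Otimes>\<^sub>M \<mu>)" by measurable
  have "AE p in \<mu> \<Otimes>\<^sub>M seq_law. left_prod ((\<lambda>(A, \<omega>). prepend A \<omega>) p) \<longlonglongrightarrow> L ((\<lambda>(A, \<omega>). prepend A \<omega>) p)"
    by (rule AE_distrD[OF prepend_measurable]) (simp only: distr_prepend canonical_limit(2)[OF L])
  from seq_pair.AE_pair[OF this]
  have shifted: "AE A in \<mu>. AE \<omega> in seq_law. L (prepend A \<omega>) = L \<omega> ** A"
  proof eventually_elim
    case (elim A)
    with canonical_limit(2)[OF L] show ?case
    proof eventually_elim
      case (elim \<omega>)
      have "(\<lambda>n. left_prod \<omega> n ** A) \<longlonglongrightarrow> L \<omega> ** A"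
        using elim(1) unfolding matrix_matrix_mult_def by (intro tendsto_intros)
      \<comment> \<open>The sequence with \<open>A\<close> inserted is one factor ahead, so its
        limit is read along the indices \<open>Suc n\<close>.\<close>
      moreover have "(\<lambda>n. left_prod \<omega> n ** A) \<longlonglongrightarrow> L (prepend A \<omega>)"
        using LIMSEQ_Suc[OF elim(2)] by (simp only: left_prod_prepend case_prod_conv)
      ultimately show ?case using LIMSEQ_unique by blast
    qed
  qed
  interpret Q: pair_sigma_finite seq_law \<mu> ..
  have "(\<integral>\<^sup>+v. f v \<partial>distr (\<rho> \<Otimes>\<^sub>M \<mu>) borel (\<lambda>(v, A). v v* A)) = (\<integral>\<^sup>+v. (\<integral>\<^sup>+A. f (v v* A) \<partial>\<mu>) \<partial>\<rho>)"
    using nn_integral_fst[OF m] by (simp add: nn_integral_distr case_prod_unfold)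
  also have "\<dots> = (\<integral>\<^sup>+\<omega>. (\<integral>\<^sup>+A. f (row i (L \<omega>) v* A) \<partial>\<mu>) \<partial>seq_law)"
    unfolding \<rho>_def by (rule nn_integral_distr) measurable
  also have "\<dots> = (\<integral>\<^sup>+A. (\<integral>\<^sup>+\<omega>. f (row i (L \<omega>) v* A) \<partial>seq_law) \<partial>\<mu>)"
    by (rule Q.Fubini'[symmetric]) measurable
  also have "\<dots> = (\<integral>\<^sup>+A. (\<integral>\<^sup>+\<omega>. f (row i (L (prepend A \<omega>))) \<partial>seq_law) \<partial>\<mu>)"
  proof (rule nn_integral_cong_AE)
    show "AE A in \<mu>. (\<integral>\<^sup>+\<omega>. f (row i (L \<omega>) v* A) \<partial>seq_law)
        = (\<integral>\<^sup>+\<omega>. f (row i (L (prepend A \<omega>))) \<partial>seq_law)"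
      using shifted
    proof eventually_elim
      case (elim A)
      then have "AE \<omega> in seq_law. f (row i (L \<omega>) v* A) = f (row i (L (prepend A \<omega>)))"
        by eventually_elim (simp add: row_matrix_matrix_mult)
      then show ?case by (rule nn_integral_cong_AE)
    qed
  qed
  also have "\<dots> = (\<integral>\<^sup>+\<omega>. f (row i (L \<omega>)) \<partial>seq_law)"
    by (rule nn_integral_prepend[symmetric]) measurable
  also have "\<dots> = (\<integral>\<^sup>+v. f v \<partial>\<rho>)"
    unfolding \<rho>_def by (rule nn_integral_distr[symmetric]) measurable
  finally show "(\<integral>\<^sup>+v. f v \<partial>distr (\<rho> \<Otimes>\<^sub>M \<mu>) borel (\<lambda>(v, A). v v* A)) = (\<integral>\<^sup>+v. f v \<partial>\<rho>)" .
qed (simp add: \<rho>_def)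

text \<open>Positivity of finitely many entries is an open condition, so a positive limit forces
  positive products at late times. If each time had probability 0, so would the countable union of
  these events.\<close>

lemma reaches_positive_of_limit:
  assumes L: "as_limit seq_law (\<lambda>n \<omega>. \<omega> n) L"
    and pos: "AE \<omega> in seq_law. \<forall>i j. 0 < L \<omega> $ i $ j"
  shows "reaches_positive seq_law (\<lambda>n \<omega>. \<omega> n)"
proof (rule ccontr)
  assume "\<not> ?thesis"
  then have zero: "measure seq_law {\<omega> \<in> space seq_law. left_prod \<omega> m \<in> pos_stochastic_mats} = 0" if "1 \<le> m" for m
    using that unfolding reaches_positive_def zero_less_measure_iff by blast
  have "AE \<omega> in seq_law. 1 \<le> m \<longrightarrow> left_prod \<omega> m \<notin> pos_stochastic_mats" for m
  proof (cases "1 \<le> m")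
    case True
    then show ?thesis using zero[OF True] by (subst (asm) seq.prob_eq_0) auto
  qed simp
  then have "AE \<omega> in seq_law. \<forall>m\<ge>1. left_prod \<omega> m \<notin> pos_stochastic_mats"
    by (simp add: AE_all_countable)
  with pos canonical_limit(2)[OF L] AE_left_prod_stochastic have "AE \<omega> in seq_law. False"
  proof eventually_elim
    case (elim \<omega>)
    have "\<forall>\<^sub>F n in sequentially. 0 < left_prod \<omega> n $ i $ j" for i j
      by (rule order_tendstoD(1)[OF tendsto_vec_nth[OF tendsto_vec_nth[OF elim(2)]]]) (use elim(1) in auto)
    then have "\<forall>\<^sub>F n in sequentially. \<forall>i j. 0 < left_prod \<omega> n $ i $ j"
      by (simp add: eventually_all_finite)
    \<comment> \<open>\<open>reaches_positive\<close> asks for a product with at least one factor,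
      hence the lower bound on \<open>n\<close>.\<close>
    then obtain n where "1 \<le> n" "\<forall>i j. 0 < left_prod \<omega> n $ i $ j"
      using eventually_happens'[OF _ eventually_conj[OF eventually_ge_at_top[of 1]]] by fastforce
    then show ?case using elim(3,4) by (auto simp: pos_stochastic_mats_def)
  qed
  then show False by simp
qed

end

section \<open>The Dirichlet class\<close>

text \<open>Turns [C1], which is formulated on the space of \<open>X\<close>, into an equation for
  the law of \<open>X\<close> alone.\<close>

lemma distr_vector_matrix_mult_map_snd:
  fixes \<rho> :: "(real^'n::finite) measure" and X :: "'a \<Rightarrow> real^'n^'n"
  assumes "prob_space M" and [measurable]: "X \<in> borel_measurable M" and [measurable_cong]: "sets \<rho> = sets borel"
  shows "distr (\<rho> \<Otimes>\<^sub>M M) borel (\<lambda>(v, \<omega>). v v* X \<omega>)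
    = distr (\<rho> \<Otimes>\<^sub>M distr M borel X) borel (\<lambda>(v, A). v v* A)"
proof -
  interpret M: prob_space M by fact
  interpret X: prob_space "distr M borel X" by (rule M.prob_space_distr) measurable
  have "\<rho> \<Otimes>\<^sub>M distr M borel X = distr \<rho> \<rho> (\<lambda>v. v) \<Otimes>\<^sub>M distr M borel X" by simp
  also have "\<dots> = distr (\<rho> \<Otimes>\<^sub>M M) (\<rho> \<Otimes>\<^sub>M borel) (\<lambda>(v, \<omega>). (v, X \<omega>))"
    by (rule pair_measure_distr) (auto simp: X.sigma_finite_measure_axioms)
  finally have eq: "\<rho> \<Otimes>\<^sub>M distr M borel X = distr (\<rho> \<Otimes>\<^sub>M M) (\<rho> \<Otimes>\<^sub>M borel) (\<lambda>(v, \<omega>). (v, X \<omega>))" .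
  show ?thesis unfolding eq by (subst distr_distr) (auto simp: comp_def case_prod_unfold)
qed

text \<open>Independence of the generated sigma-algebras is the product formula on measurable
  rectangles, and these determine the joint law.\<close>

lemma indep_rvs_distr_pair:
  fixes X :: "'a \<Rightarrow> 'c::second_countable_topology" and Y :: "'a \<Rightarrow> 'd::second_countable_topology"
  assumes "prob_space M" and ind: "indep_rvs M Y X"
  shows "distr M borel Y \<Otimes>\<^sub>M distr M borel X = distr M (borel \<Otimes>\<^sub>M borel) (\<lambda>\<omega>. (Y \<omega>, X \<omega>))"
proof -
  interpret M: prob_space M by fact
  have [measurable]: "Y \<in> borel_measurable M" "X \<in> borel_measurable M"
    using ind by (auto simp: indep_rvs_def)
  show ?thesis
  proof (rule pair_measure_eqI)
    show "sigma_finite_measure (distr M borel Y)" "sigma_finite_measure (distr M borel X)"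
      by (auto intro!: prob_space_imp_sigma_finite M.prob_space_distr)
    fix A B assume "A \<in> sets (distr M borel Y)" "B \<in> sets (distr M borel X)"
    then have AB[measurable]: "A \<in> sets borel" "B \<in> sets borel" by auto
    have "M.prob ((Y -` A \<inter> space M) \<inter> (X -` B \<inter> space M))
        = M.prob (Y -` A \<inter> space M) * M.prob (X -` B \<inter> space M)"
      using ind AB by (intro M.indep_setD) (auto simp: indep_rvs_def)
    moreover have "(Y -` A \<inter> space M) \<inter> (X -` B \<inter> space M) = (\<lambda>\<omega>. (Y \<omega>, X \<omega>)) -` (A \<times> B) \<inter> space M"
      by auto
    ultimately show "emeasure (distr M borel Y) A * emeasure (distr M borel X) B
        = emeasure (distr M (borel \<Otimes>\<^sub>M borel) (\<lambda>\<omega>. (Y \<omega>, X \<omega>))) (A \<times> B)"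
      by (simp add: emeasure_distr M.emeasure_eq_measure ennreal_mult)
  qed simp
qed

lemma indep_rvs_distr_vector_matrix_mult:
  fixes X :: "'a \<Rightarrow> real^'n::finite^'n" and Y :: "'a \<Rightarrow> real^'n"
  assumes M: "prob_space M" and ind: "indep_rvs M Y X"
  shows "distr M borel (\<lambda>\<omega>. Y \<omega> v* X \<omega>)
    = distr (distr M borel Y \<Otimes>\<^sub>M distr M borel X) borel (\<lambda>(v, A). v v* A)"
proof -
  have [measurable]: "Y \<in> borel_measurable M" "X \<in> borel_measurable M"
    using ind by (auto simp: indep_rvs_def)
  show ?thesis
    unfolding indep_rvs_distr_pair[OF M ind] by (subst distr_distr) (auto simp: comp_def case_prod_unfold)
qed

lemma pos_entries_of_row_law:
  fixes L :: "'a \<Rightarrow> real^'n::{finite,linorder}^'n::{finite,linorder}"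
  assumes [measurable]: "L \<in> borel_measurable M"
    and law: "\<And>i. distr M borel (\<lambda>\<omega>. row i (L \<omega>)) = dirichlet_law a"
  shows "AE \<omega> in M. \<forall>i j. 0 < L \<omega> $ i $ j"
proof -
  have "AE \<omega> in M. \<forall>j. 0 < L \<omega> $ i $ j" for i
  proof -
    have "(\<lambda>\<omega>. row i (L \<omega>)) \<in> M \<rightarrow>\<^sub>M borel" by measurable
    moreover have "AE x in distr M borel (\<lambda>\<omega>. row i (L \<omega>)). x \<in> prob_simplex \<and> (\<forall>j. 0 < x $ j)"
      unfolding law by (rule AE_dirichlet_law)
    ultimately have "AE \<omega> in M. row i (L \<omega>) \<in> prob_simplex \<and> (\<forall>j. 0 < row i (L \<omega>) $ j)"
      by (rule AE_distrD)
    then show ?thesis by eventually_elim (simp add: row_def)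
  qed
  then show ?thesis by (simp add: eventually_all_finite)
qed

text \<open>The limit \<open>L\<close> is given before \<open>t\<close>, so every vector satisfying
  [C1] yields the Dirichlet law of the same rows.\<close>

lemma limit_row_gamma:
  fixes \<mu> :: "(real^'n::{finite,linorder}^'n::{finite,linorder}) measure"
  assumes "random_stochastic \<mu>" "as_limit (Pi\<^sub>M {1..} (\<lambda>_. \<mu>)) (\<lambda>n \<omega>. \<omega> n) L"
    and "AE \<omega> in Pi\<^sub>M {1..} (\<lambda>_. \<mu>). \<forall>i j. row i (L \<omega>) = row j (L \<omega>)"
    and t: "t \<in> pos_vecs" and "distr (gamma_vec_law t \<Otimes>\<^sub>M \<mu>) borel (\<lambda>(v, A). v v* A) = gamma_vec_law t"
  shows "distr (Pi\<^sub>M {1..} (\<lambda>_. \<mu>)) borel (\<lambda>\<omega>. row i (L \<omega>)) = dirichlet_law t"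
  using random_stochastic.limit_row_law[OF assms(1-3) prob_space_gamma_vec_law[OF t] _ assms(5) AE_gamma_vec_law[OF t]]
  by (simp add: distr_normalized_gamma_vec_law[OF t])

text \<open>One vector serves in both directions: the parameter of the Dirichlet rows is a witness
  for [C1], and a witness for [C1] is the parameter of the rows.\<close>

lemma dirichlet_class_iff:
  fixes \<mu> :: "(real^'n::{finite,linorder}^'n::{finite,linorder}) measure"
  assumes "random_stochastic \<mu>"
  shows "\<mu> \<in> dirichlet_class \<longleftrightarrow>
    (\<exists>t\<in>pos_vecs. distr (gamma_vec_law t \<Otimes>\<^sub>M \<mu>) borel (\<lambda>(v, A). v v* A) = gamma_vec_law t) \<and>
    reaches_positive (Pi\<^sub>M {1..} (\<lambda>_. \<mu>)) (\<lambda>n \<omega>. \<omega> n)"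
proof -
  interpret random_stochastic \<mu> by fact
  show ?thesis
  proof (intro iffI)
    assume "\<mu> \<in> dirichlet_class"
    then obtain L a where L: "as_limit seq_law (\<lambda>n \<omega>. \<omega> n) L" and a: "a \<in> pos_vecs"
      and law: "\<And>i. distr seq_law borel (\<lambda>\<omega>. row i (L \<omega>)) = dirichlet_law a"
      unfolding dirichlet_class_def by blast
    have "reaches_positive seq_law (\<lambda>n \<omega>. \<omega> n)"
      using pos_entries_of_row_law[OF canonical_limit(1)[OF L] law] by (rule reaches_positive_of_limit[OF L])
    moreover have "distr (gamma_vec_law a \<Otimes>\<^sub>M \<mu>) borel (\<lambda>(v, A). v v* A) = gamma_vec_law a"
      using limit_row_invariant[OF L] unfolding law
      by (intro gamma_vec_law_invariantI a prob_space_axioms sets_law)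
    ultimately show "(\<exists>t\<in>pos_vecs. distr (gamma_vec_law t \<Otimes>\<^sub>M \<mu>) borel (\<lambda>(v, A). v v* A) = gamma_vec_law t) \<and>
      reaches_positive seq_law (\<lambda>n \<omega>. \<omega> n)" using a by blast
  next
    assume "(\<exists>t\<in>pos_vecs. distr (gamma_vec_law t \<Otimes>\<^sub>M \<mu>) borel (\<lambda>(v, A). v v* A) = gamma_vec_law t) \<and>
      reaches_positive seq_law (\<lambda>n \<omega>. \<omega> n)"
    then obtain t m where t: "t \<in> pos_vecs"
      and inv: "distr (gamma_vec_law t \<Otimes>\<^sub>M \<mu>) borel (\<lambda>(v, A). v v* A) = gamma_vec_law t"
      and m: "0 < measure seq_law {\<omega> \<in> space seq_law. left_prod \<omega> m \<in> pos_stochastic_mats}"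
      unfolding reaches_positive_def by auto
    \<comment> \<open>Taking \<open>lim\<close> at every point makes \<open>L\<close> measurable at
      once; its values where the products diverge matter only on a null set.\<close>
    define L where "L \<omega> = lim (left_prod \<omega>)" for \<omega> :: "nat \<Rightarrow> real^'n::{finite,linorder}^'n::{finite,linorder}"
    have "AE \<omega> in seq_law. left_prod \<omega> \<longlonglongrightarrow> L \<omega> \<and> (\<forall>i j. row i (L \<omega>) = row j (L \<omega>))"
      using AE_left_prod_convergent[OF m] by eventually_elim (metis L_def limI)
    then have lim: "AE \<omega> in seq_law. left_prod \<omega> \<longlonglongrightarrow> L \<omega>"
      and rows: "AE \<omega> in seq_law. \<forall>i j. row i (L \<omega>) = row j (L \<omega>)"
      by (auto elim: eventually_mono)
    have "L \<in> borel_measurable seq_law" unfolding L_def by measurable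
    then have L: "as_limit seq_law (\<lambda>n \<omega>. \<omega> n) L" using lim by (simp add: as_limit_def)
    show "\<mu> \<in> dirichlet_class"
      unfolding dirichlet_class_def
      using prob_space_axioms sets_law AE_stochastic L rows t
        limit_row_gamma[OF random_stochastic_axioms L rows t inv] by blast
  qed
qed

section \<open>Transfer from the canonical product space to arbitrary i.i.d. sequences\<close>

theorem theorem4:
  fixes M :: "'a measure" and N :: "'b measure"
    and X :: "'a \<Rightarrow> real^'n::{finite,linorder}^'n::{finite,linorder}"
    and Xs :: "nat \<Rightarrow> 'b \<Rightarrow> real^'n::{finite,linorder}^'n::{finite,linorder}"
  assumes "prob_space M"
    and "X \<in> borel_measurable M"
    and "\<And>\<omega>. \<omega> \<in> space M \<Longrightarrow> X \<omega> \<in> stochastic_mats"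
    and "prob_space N"
    and "prob_space.indep_vars N (\<lambda>_. borel) Xs {1..}"
    and "\<And>n. n \<ge> 1 \<Longrightarrow> distr N borel (Xs n) = distr M borel X"
  shows "(distr M borel X \<in> dirichlet_class \<longleftrightarrow> (\<exists>t. gamma_invariant M X t) \<and> reaches_positive N Xs)
    \<and> (distr M borel X \<in> dirichlet_class \<longrightarrow>
        (\<exists>L. as_limit N Xs L \<and>
          (\<forall>t. gamma_invariant M X t \<longrightarrow>
             distr N borel (\<lambda>\<omega>. row first_ix (L \<omega>)) = dirichlet_law t) \<and>
          (\<forall>Y. (\<forall>\<omega>\<in>space M. Y \<omega> \<in> prob_simplex) \<and> indep_rvs M Y X \<longrightarrow>
             (distr M borel (\<lambda>\<omega>. Y \<omega> v* X \<omega>) = distr M borel Y \<longleftrightarrow>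
              distr M borel Y = distr N borel (\<lambda>\<omega>. row first_ix (L \<omega>))))))"
proof -
  interpret M: prob_space M by fact
  interpret N: prob_space N by fact
  note assms(2)[measurable]
  define \<mu> where "\<mu> = distr M borel X"
  interpret random_stochastic \<mu>
  proof (intro random_stochastic.intro random_stochastic_axioms.intro)
    show "prob_space \<mu>" unfolding \<mu>_def by (rule M.prob_space_distr) measurable
    show "AE A in \<mu>. A \<in> stochastic_mats"
      unfolding \<mu>_def by (subst AE_distr_iff) (use assms(3) in auto)
  qed (simp add: \<mu>_def)
  \<comment> \<open>Only the indices from 1 on are constrained, so \<open>Xs 0\<close> is discarded
    and \<open>T\<close> takes values in the canonical space.\<close>
  define T where "T \<omega> = (\<lambda>i\<in>{1..}. Xs i \<omega>)" for \<omega>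
  have Xs[measurable]: "Xs i \<in> borel_measurable N" if "i \<in> {1..}" for i
    using assms(5) that by (auto simp: N.indep_vars_def)
  have T_meas[measurable]: "T \<in> N \<rightarrow>\<^sub>M seq_law"
    unfolding T_def
  proof (rule measurable_restrict)
    fix i :: nat assume "i \<in> {1..}"
    then show "Xs i \<in> N \<rightarrow>\<^sub>M \<mu>" using Xs by (simp add: measurable_cong_sets[OF refl sets_law])
  qed
  \<comment> \<open>Independence says that the joint law is the product of the marginals, each of
    which equals \<open>\<mu>\<close>.\<close>
  have "distr N (Pi\<^sub>M {1..} (\<lambda>_. borel)) T = Pi\<^sub>M {1..} (\<lambda>i. distr N borel (Xs i))"
    unfolding T_def using assms(5) Xs by (subst N.indep_vars_iff_distr_eq_PiM'[symmetric]) auto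
  also have "\<dots> = seq_law" by (rule PiM_cong) (simp_all add: \<mu>_def assms(6))
  also have "distr N (Pi\<^sub>M {1..} (\<lambda>_. borel)) T = distr N seq_law T"
    by (rule distr_cong) (auto intro!: sets_PiM_cong)
  finally have T_law: "distr N seq_law T = seq_law" .
  have left_T: "left_prod (T \<omega>) = left_prod (\<lambda>k. Xs k \<omega>)" for \<omega>
    by (rule ext, rule left_prod_cong) (simp add: T_def)
  have reaches: "reaches_positive N Xs \<longleftrightarrow> reaches_positive seq_law (\<lambda>n \<omega>. \<omega> n)"
  proof -
    have "measure seq_law {\<omega> \<in> space seq_law. left_prod \<omega> m \<in> pos_stochastic_mats}
        = measure N {\<omega> \<in> space N. left_prod (\<lambda>k. Xs k \<omega>) m \<in> pos_stochastic_mats}" for m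
    proof -
      have "measure (distr N seq_law T) {\<omega> \<in> space seq_law. left_prod \<omega> m \<in> pos_stochastic_mats}
          = measure N (T -` {\<omega> \<in> space seq_law. left_prod \<omega> m \<in> pos_stochastic_mats} \<inter> space N)"
        by (rule measure_distr) measurable
      also have "T -` {\<omega> \<in> space seq_law. left_prod \<omega> m \<in> pos_stochastic_mats} \<inter> space N
          = {\<omega> \<in> space N. left_prod (\<lambda>k. Xs k \<omega>) m \<in> pos_stochastic_mats}"
        using measurable_space[OF T_meas] by (auto simp: left_T)
      finally show ?thesis by (simp only: T_law)
    qed
    then show ?thesis by (simp add: reaches_positive_def)
  qed
  have gamma: "gamma_invariant M X t \<longleftrightarrow> t \<in> pos_vecs \<and>
      distr (gamma_vec_law t \<Otimes>\<^sub>M \<mu>) borel (\<lambda>(v, A). v v* A) = gamma_vec_law t" for t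
    unfolding gamma_invariant_def \<mu>_def
    by (subst distr_vector_matrix_mult_map_snd) (auto simp: M.prob_space_axioms)
  have class_iff: "\<mu> \<in> dirichlet_class \<longleftrightarrow> (\<exists>t. gamma_invariant M X t) \<and> reaches_positive N Xs"
    unfolding dirichlet_class_iff[OF random_stochastic_axioms] reaches gamma by blast
  moreover have "\<exists>L. as_limit N Xs L \<and>
      (\<forall>t. gamma_invariant M X t \<longrightarrow> distr N borel (\<lambda>\<omega>. row first_ix (L \<omega>)) = dirichlet_law t) \<and>
      (\<forall>Y. (\<forall>\<omega>\<in>space M. Y \<omega> \<in> prob_simplex) \<and> indep_rvs M Y X \<longrightarrow>
         (distr M borel (\<lambda>\<omega>. Y \<omega> v* X \<omega>) = distr M borel Y \<longleftrightarrow>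
          distr M borel Y = distr N borel (\<lambda>\<omega>. row first_ix (L \<omega>))))"
    if in_class: "\<mu> \<in> dirichlet_class"
  proof -
    obtain L where L: "as_limit seq_law (\<lambda>n \<omega>. \<omega> n) L"
      and rows: "AE \<omega> in seq_law. \<forall>i j. row i (L \<omega>) = row j (L \<omega>)"
      using in_class unfolding dirichlet_class_def by blast
    note canonical_limit(1)[OF L, measurable]
    have row_law: "distr N borel (\<lambda>\<omega>. row i (L (T \<omega>))) = distr seq_law borel (\<lambda>\<omega>. row i (L \<omega>))" for i
    proof -
      have "distr (distr N seq_law T) borel (\<lambda>\<omega>. row i (L \<omega>)) = distr N borel (\<lambda>\<omega>. row i (L (T \<omega>)))"
        by (subst distr_distr) (auto simp: comp_def)
      then show ?thesis by (simp only: T_law)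
    qed
    \<comment> \<open>The limit on \<open>N\<close> is the canonical one composed with
      \<open>T\<close>, which pulls null sets back to null sets.\<close>
    have "AE \<omega> in N. left_prod (T \<omega>) \<longlonglongrightarrow> L (T \<omega>)"
      by (rule AE_distrD[OF T_meas]) (simp only: T_law canonical_limit(2)[OF L])
    then have limit: "as_limit N Xs (\<lambda>\<omega>. L (T \<omega>))"
      by (simp add: as_limit_def left_T)
    have uniq: "distr M borel (\<lambda>\<omega>. Y \<omega> v* X \<omega>) = distr M borel Y \<longleftrightarrow>
          distr M borel Y = distr N borel (\<lambda>\<omega>. row first_ix (L (T \<omega>)))"
      if Y: "\<forall>\<omega>\<in>space M. Y \<omega> \<in> prob_simplex" and ind: "indep_rvs M Y X" for Y
    proof -
      have [measurable]: "Y \<in> borel_measurable M" using ind by (simp add: indep_rvs_def)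
      let ?\<eta> = "distr M borel Y"
      have simplex: "AE v in ?\<eta>. v \<in> prob_simplex"
        by (subst AE_distr_iff) (use Y in auto)
      \<comment> \<open>\<open>normalized\<close> is the identity on the simplex, so
        \<open>limit_row_law\<close> identifies the law of \<open>Y\<close> itself.\<close>
      have "distr ?\<eta> borel normalized = distr ?\<eta> borel (\<lambda>v. v)"
      proof (rule distr_cong_AE)
        show "AE v in ?\<eta>. normalized v = v"
          using simplex by eventually_elim (simp add: normalized_def prob_simplex_def)
      qed auto
      then have normalized: "distr ?\<eta> borel normalized = ?\<eta>" by (simp add: distr_distr comp_def)
      have pos: "AE v in ?\<eta>. 0 < (\<Sum>i\<in>UNIV. v $ i)"
        using simplex by eventually_elim (simp add: prob_simplex_def)
      have "?\<eta> = distr seq_law borel (\<lambda>\<omega>. row first_ix (L \<omega>))"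
        if "distr (?\<eta> \<Otimes>\<^sub>M \<mu>) borel (\<lambda>(v, A). v v* A) = ?\<eta>"
        using limit_row_law[OF L rows M.prob_space_distr _ that pos, of first_ix] normalized by simp
      \<comment> \<open>The other implication is the invariance of the law of the limit row.\<close>
      then show ?thesis
        unfolding indep_rvs_distr_vector_matrix_mult[OF M.prob_space_axioms ind] row_law \<mu>_def[symmetric]
        using limit_row_invariant[OF L, of first_ix] by auto
    qed
    show ?thesis
      using limit uniq limit_row_gamma[OF random_stochastic_axioms L rows]
      by (intro exI[of _ "\<lambda>\<omega>. L (T \<omega>)"]) (auto simp: gamma row_law)
  qed
  ultimately show ?thesis unfolding \<mu>_def by blast
qed

end
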